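(* Let $\mathbf{P}$ be a connected, essentially finite poset such that $(\mathbf{Con}(\mathbf{P}),\subset)$ is locally finite. Let $F:\mathbf{P}\to\mathcal{C}$ be a functor, where $\mathcal{C}$ is a category satisfying the standing assumptions given in the context. Let $\mu:\mathbf{Con}^{\mathrm{op}}(\mathbf{P})\times\mathbf{Con}^{\mathrm{op}}(\mathbf{P})\to\mathbb{Z}$ be the Möbius function of the poset $\mathbf{Con}^{\mathrm{op}}(\mathbf{P})$. Then, for every $I\in\mathbf{Con}^{\mathrm{op}}(\mathbf{P})$, $$\mathrm{dgm}^{\mathbf{P}}(F)(I)=\sum_{J\supset I}\mathrm{rk}(F)(J)\cdot\mu(J,I),$$ where $J$ ranges over elements of $\mathbf{Con}(\mathbf{P})$ containing $I$.
   Context: Standing assumptions on $\mathcal{C}$: $(\mathcal{C},\square)$ is an essentially small symmetric monoidal category, and at least one of the following holds. (a) $\mathcal{C}$ is bicomplete and every morphism of $\mathcal{C}$ has an image. (b) $\mathcal{C}$ is a full subcategory of a bicomplete category $\mathcal{D}$ in which every morphism has an epimorphic image, such that for any monomorphism $a\hookrightarrow b$ in $\mathcal{D}$ with $b\in\mathcal{C}$ one has $a\in\mathcal{C}$, and for any epimorphism $c\twoheadrightarrow d$ in $\mathcal{D}$ with $c\in\mathcal{C}$ one has $d\in\mathcal{C}$. Here an image of $f:a\to b$ is a factorization $f=h\circ g$, $g:a\to\mathrm{im}(f)$, $h:\mathrm{im}(f)\hookrightarrow b$ a monomorphism, such that for any factorization $f=h'\circ g'$ with $h':z\hookrightarrow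 b$ a monomorphism there is a unique $u:\mathrm{im}(f)\to z$ with $u\circ g=g'$ and $h'\circ u=h$; it is an epimorphic image if $g$ is an epimorphism. $\mathcal{I}(\mathcal{C})$ is the commutative monoid of isomorphism classes of objects of $\mathcal{C}$ with $[a]+[b]=[a\,\square\, b]$, and $\mathcal{A}(\mathcal{C})$ is its group completion; elements of $\mathcal{I}(\mathcal{C})$ are regarded in $\mathcal{A}(\mathcal{C})$ via the canonical map. Posets. A poset is regarded as a category with a unique morphism $p\to q$ iff $p\le q$. A poset $\mathbf{P}$ is connected if any two elements are joined by a finite sequence of consecutively comparable elements; it is locally finite if $\{r:p\le r\le q\}$ is finite for all $p\le q$. Write $p\asymp q$ if one of $p,q$ covers the other. $\mathrm{Hasse}(\mathbf{P})$ is the simple graph on $\mathbf{P}$ with $p,q$ adjacent iff $p\asymp q$. $\mathbf{Con}(\mathbf{P})$ is the collection of all subposets $I\subset\mathbf{P}$ such that the induced subgraph of $\mathrm{Hasse}(\mathbf{P})$ on $I$ is a connected (nonempty) graph, ordered by inclusion; $\mathbf{Con}^{\mathrm{op}}(\mathbf{P})$ is the opposite poset, so $J\le I$ in it iff $J\supset I$. For $I\in\mathbf{Con}(\mathbf{P})$, $\mathrm{nbd}(I)=\{p\in\mathbf{P}\setminus I:\exists q\in I,\ q\asymp p\}$ and $o_I=|\mathrm{nbd}(I)|$. $\mathbf{P}$ is essentially finite if it is locally finite and every $o_I$ is finite. For $n\ge1$, $I^n$ is the set of $J$ with $I\subset J\subset I\cup\mathrm{nbd}(I)$ and $|J\cap\mathrm{nbd}(I)|=n$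 (these lie in $\mathbf{Con}(\mathbf{P})$). Rank invariant: $\mathrm{rk}(F):\mathbf{Con}(\mathbf{P})\to\mathcal{I}(\mathcal{C})$ sends $I$ to the isomorphism class of the image of the canonical map $\varprojlim F|_I\to\varinjlim F|_I$, i.e. the composite $\varprojlim F|_I\to F_a\to\varinjlim F|_I$ for any $a\in I$ (independent of $a$); in case (b) limits, colimits and images are taken in $\mathcal{D}$ (the image lies in $\mathcal{C}$). Persistence diagram: $\mathrm{dgm}^{\mathbf{P}}(F):\mathbf{Con}(\mathbf{P})\to\mathcal{A}(\mathcal{C})$ is $$\mathrm{dgm}^{\mathbf{P}}(F)(I)=\mathrm{rk}(F)(I)-\sum_{J\in I^1}\mathrm{rk}(F)(J)+\sum_{K\in I^2}\mathrm{rk}(F)(K)-\cdots+(-1)^{o_I}\sum_{L\in I^{o_I}}\mathrm{rk}(F)(L).$$ Möbius function of a locally finite poset $\mathbf{Q}$: $\mu(p,p)=1$; $\mu(p,q)=-\sum_{p\le r<q}\mu(p,r)$ if $p<q$; $\mu(p,q)=0$ otherwise. A possibly infinite sum $\sum_{J\supset I}\mathrm{rk}(F)(J)\mu(J,I)$ is understood as the sum over those $J$ with $\mu(J,I)\neq0$. *)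

theory Defs
  imports "HOL-Algebra.FiniteProduct" "HOL-Library.Equipollence"
begin

section \<open>Categories and functors\<close>

record ('o, 'm) cat =
  Obj :: "'o set"
  Arr :: "'m set"
  Dom :: "'m \<Rightarrow> 'o"
  Cod :: "'m \<Rightarrow> 'o"
  Ident :: "'o \<Rightarrow> 'm"
  Comp :: "'m \<Rightarrow> 'm \<Rightarrow> 'm"  (infixl \<open>\<cdot>\<index>\<close> 70)

definition Hom :: "('o, 'm) cat \<Rightarrow> 'o \<Rightarrow> 'o \<Rightarrow> 'm set" where
  "Hom C a b = {f \<in> Arr C. Dom C f = a \<and> Cod C f = b}"

locale category =
  fixes C :: "('o, 'm) cat" (structure)
  assumes Dom_Obj: "f \<in> Arr C \<Longrightarrow> Dom C f \<in> Obj C"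
    and Cod_Obj: "f \<in> Arr C \<Longrightarrow> Cod C f \<in> Obj C"
    and Ident_Hom: "a \<in> Obj C \<Longrightarrow> Ident C a \<in> Hom C a a"
    and Comp_Hom: "\<lbrakk>f \<in> Hom C a b; g \<in> Hom C b c\<rbrakk> \<Longrightarrow> g \<cdot> f \<in> Hom C a c"
    and Comp_Ident: "f \<in> Hom C a b \<Longrightarrow> f \<cdot> Ident C a = f"
    and Ident_Comp: "f \<in> Hom C a b \<Longrightarrow> Ident C b \<cdot> f = f"
    and Comp_assoc: "\<lbrakk>f \<in> Hom C a b; g \<in> Hom C b c; h \<in> Hom C c d\<rbrakk>
                      \<Longrightarrow> h \<cdot> g \<cdot> f = h \<cdot> (g \<cdot> f)"

definition iso_arr :: "('o, 'm) cat \<Rightarrow> 'm \<Rightarrow> bool" where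
  "iso_arr C f \<longleftrightarrow> f \<in> Arr C \<and>
     (\<exists>g \<in> Hom C (Cod C f) (Dom C f). g \<cdot>\<^bsub>C\<^esub> f = Ident C (Dom C f) \<and> f \<cdot>\<^bsub>C\<^esub> g = Ident C (Cod C f))"

definition isomorphic :: "('o, 'm) cat \<Rightarrow> 'o \<Rightarrow> 'o \<Rightarrow> bool" where
  "isomorphic C a b \<longleftrightarrow> a \<in> Obj C \<and> b \<in> Obj C \<and> (\<exists>f \<in> Hom C a b. iso_arr C f)"

definition monic :: "('o, 'm) cat \<Rightarrow> 'm \<Rightarrow> bool" where
  "monic C h \<longleftrightarrow> h \<in> Arr C \<and>
     (\<forall>x. \<forall>u \<in> Hom C x (Dom C h). \<forall>v \<in> Hom C x (Dom C h). h \<cdot>\<^bsub>C\<^esub> u = h \<cdot>\<^bsub>C\<^esub> v \<longrightarrow> u = v)"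

definition epic :: "('o, 'm) cat \<Rightarrow> 'm \<Rightarrow> bool" where
  "epic C g \<longleftrightarrow> g \<in> Arr C \<and>
     (\<forall>x. \<forall>u \<in> Hom C (Cod C g) x. \<forall>v \<in> Hom C (Cod C g) x. u \<cdot>\<^bsub>C\<^esub> g = v \<cdot>\<^bsub>C\<^esub> g \<longrightarrow> u = v)"

definition mono_factorization :: "('o, 'm) cat \<Rightarrow> 'm \<Rightarrow> 'm \<Rightarrow> 'm \<Rightarrow> bool" where
  "mono_factorization C f g h \<longleftrightarrow>
     monic C h \<and> g \<in> Hom C (Dom C f) (Dom C h) \<and> Cod C h = Cod C f \<and> f = h \<cdot>\<^bsub>C\<^esub> g"

text \<open>The image object of \<open>f\<close> is \<open>Dom C h\<close>.\<close>
definition image_factorization :: "('o, 'm) cat \<Rightarrow> 'm \<Rightarrow> 'm \<Rightarrow> 'm \<Rightarrow> bool" where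
  "image_factorization C f g h \<longleftrightarrow> mono_factorization C f g h \<and>
     (\<forall>g' h'. mono_factorization C f g' h' \<longrightarrow>
        (\<exists>!u. u \<in> Hom C (Dom C h) (Dom C h') \<and> u \<cdot>\<^bsub>C\<^esub> g = g' \<and> h' \<cdot>\<^bsub>C\<^esub> u = h))"

record ('a, 'b, 'o, 'm) functor_data =
  ob :: "'a \<Rightarrow> 'o"
  ar :: "'b \<Rightarrow> 'm"

locale cat_functor = J: category J + C: category C
  for J :: "('a, 'b) cat" and C :: "('o, 'm) cat" +
  fixes F :: "('a, 'b, 'o, 'm) functor_data"
  assumes ob_Obj: "j \<in> Obj J \<Longrightarrow> ob F j \<in> Obj C"
    and ar_Hom: "u \<in> Hom J i j \<Longrightarrow> ar F u \<in> Hom C (ob F i) (ob F j)"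
    and ar_Ident: "j \<in> Obj J \<Longrightarrow> ar F (Ident J j) = Ident C (ob F j)"
    and ar_Comp: "\<lbrakk>u \<in> Hom J i j; v \<in> Hom J j k\<rbrakk> \<Longrightarrow> ar F (v \<cdot>\<^bsub>J\<^esub> u) = ar F v \<cdot>\<^bsub>C\<^esub> ar F u"

definition id_functor :: "('a, 'b, 'a, 'b) functor_data" where
  "id_functor = \<lparr>ob = id, ar = id\<rparr>"

definition comp_functor ::
  "('c, 'd, 'o, 'm) functor_data \<Rightarrow> ('a, 'b, 'c, 'd) functor_data \<Rightarrow> ('a, 'b, 'o, 'm) functor_data" where
  "comp_functor G F = \<lparr>ob = ob G \<circ> ob F, ar = ar G \<circ> ar F\<rparr>"

definition naturally_isomorphic ::
  "('a, 'b) cat \<Rightarrow> ('o, 'm) cat \<Rightarrow> ('a, 'b, 'o, 'm) functor_data \<Rightarrow> ('a, 'b, 'o, 'm) functor_data \<Rightarrow> bool" where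
  "naturally_isomorphic J C F G \<longleftrightarrow>
     (\<exists>\<eta>. (\<forall>j \<in> Obj J. \<eta> j \<in> Hom C (ob F j) (ob G j) \<and> iso_arr C (\<eta> j)) \<and>
          (\<forall>i j. \<forall>u \<in> Hom J i j. \<eta> j \<cdot>\<^bsub>C\<^esub> ar F u = ar G u \<cdot>\<^bsub>C\<^esub> \<eta> i))"

definition equivalence_of_categories ::
  "('a, 'b) cat \<Rightarrow> ('o, 'm) cat \<Rightarrow> ('a, 'b, 'o, 'm) functor_data \<Rightarrow> ('o, 'm, 'a, 'b) functor_data \<Rightarrow> bool" where
  "equivalence_of_categories E C F G \<longleftrightarrow> cat_functor E C F \<and> cat_functor C E G \<and>
     naturally_isomorphic E E (comp_functor G F) id_functor \<and>
     naturally_isomorphic C C (comp_functor F G) id_functor"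

definition full_subcategory :: "('o, 'm) cat \<Rightarrow> ('o, 'm) cat \<Rightarrow> bool" where
  "full_subcategory C D \<longleftrightarrow> Obj C \<subseteq> Obj D \<and> (\<forall>a \<in> Obj C. Ident C a = Ident D a) \<and>
     Arr C = {f \<in> Arr D. Dom D f \<in> Obj C \<and> Cod D f \<in> Obj C} \<and>
     (\<forall>f \<in> Arr C. Dom C f = Dom D f \<and> Cod C f = Cod D f) \<and>
     (\<forall>f \<in> Arr C. \<forall>g \<in> Arr C. Dom C g = Cod C f \<longrightarrow> g \<cdot>\<^bsub>C\<^esub> f = g \<cdot>\<^bsub>D\<^esub> f)"


section \<open>Limits and colimits\<close>

definition cone :: "('a, 'b) cat \<Rightarrow> ('o, 'm) cat \<Rightarrow> ('a, 'b, 'o, 'm) functor_data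
                     \<Rightarrow> 'o \<Rightarrow> ('a \<Rightarrow> 'm) \<Rightarrow> bool" where
  "cone J C F l \<pi> \<longleftrightarrow> l \<in> Obj C \<and> (\<forall>j \<in> Obj J. \<pi> j \<in> Hom C l (ob F j)) \<and>
     (\<forall>i j. \<forall>u \<in> Hom J i j. ar F u \<cdot>\<^bsub>C\<^esub> \<pi> i = \<pi> j)"

definition limit_cone :: "('a, 'b) cat \<Rightarrow> ('o, 'm) cat \<Rightarrow> ('a, 'b, 'o, 'm) functor_data
                           \<Rightarrow> 'o \<Rightarrow> ('a \<Rightarrow> 'm) \<Rightarrow> bool" where
  "limit_cone J C F l \<pi> \<longleftrightarrow> cone J C F l \<pi> \<and>
     (\<forall>l' \<pi>'. cone J C F l' \<pi>' \<longrightarrow> (\<exists>!h. h \<in> Hom C l' l \<and> (\<forall>j \<in> Obj J. \<pi> j \<cdot>\<^bsub>C\<^esub> h = \<pi>' j)))"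

definition cocone :: "('a, 'b) cat \<Rightarrow> ('o, 'm) cat \<Rightarrow> ('a, 'b, 'o, 'm) functor_data
                       \<Rightarrow> 'o \<Rightarrow> ('a \<Rightarrow> 'm) \<Rightarrow> bool" where
  "cocone J C F k \<iota> \<longleftrightarrow> k \<in> Obj C \<and> (\<forall>j \<in> Obj J. \<iota> j \<in> Hom C (ob F j) k) \<and>
     (\<forall>i j. \<forall>u \<in> Hom J i j. \<iota> j \<cdot>\<^bsub>C\<^esub> ar F u = \<iota> i)"

definition colimit_cocone :: "('a, 'b) cat \<Rightarrow> ('o, 'm) cat \<Rightarrow> ('a, 'b, 'o, 'm) functor_data
                               \<Rightarrow> 'o \<Rightarrow> ('a \<Rightarrow> 'm) \<Rightarrow> bool" where
  "colimit_cocone J C F k \<iota> \<longleftrightarrow> cocone J C F k \<iota> \<and>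
     (\<forall>k' \<iota>'. cocone J C F k' \<iota>' \<longrightarrow> (\<exists>!h. h \<in> Hom C k k' \<and> (\<forall>j \<in> Obj J. h \<cdot>\<^bsub>C\<^esub> \<iota> j = \<iota>' j)))"


section \<open>Smallness\<close>

text \<open>Smallness is relative to a universe, represented by a type \<open>'u\<close>: a set is small iff its
  cardinality is strictly below that of \<open>'u\<close>. If the cardinality of \<open>'u\<close> is strongly
  inaccessible, this is smallness with respect to the corresponding Grothendieck universe.
  Nothing below depends on inaccessibility, so \<open>'u\<close> is left arbitrary. Every small category
  has an isomorphic copy with objects and arrows in \<open>'u\<close>; quantifying over
  \<^typ>\<open>('u, 'u) cat\<close> thus covers all small categories.\<close>

definition small :: "'u itself \<Rightarrow> 'a set \<Rightarrow> bool" where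
  "small U A \<longleftrightarrow> A \<prec> (UNIV :: 'u set)"

definition small_category :: "'u itself \<Rightarrow> ('o, 'm) cat \<Rightarrow> bool" where
  "small_category U C \<longleftrightarrow> category C \<and> small U (Obj C) \<and> small U (Arr C)"

definition essentially_small :: "'u itself \<Rightarrow> ('o, 'm) cat \<Rightarrow> bool" where
  "essentially_small U C \<longleftrightarrow>
     (\<exists>(E :: ('u, 'u) cat) F G. small_category U E \<and> equivalence_of_categories E C F G)"

definition bicomplete :: "'u itself \<Rightarrow> ('o, 'm) cat \<Rightarrow> bool" where
  "bicomplete U C \<longleftrightarrow>
     (\<forall>(J :: ('u, 'u) cat) F. small_category U J \<and> cat_functor J C F \<longrightarrow>
        (\<exists>l \<pi>. limit_cone J C F l \<pi>) \<and> (\<exists>k \<iota>. colimit_cocone J C F k \<iota>))"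


section \<open>Symmetric monoidal categories\<close>

record ('o, 'm) sym_monoidal =
  tens_ob :: "'o \<Rightarrow> 'o \<Rightarrow> 'o"  (infixl \<open>\<box>\<index>\<close> 75)
  tens_ar :: "'m \<Rightarrow> 'm \<Rightarrow> 'm"  (infixl \<open>\<boxtimes>\<index>\<close> 75)
  tens_unit :: 'o
  assoc :: "'o \<Rightarrow> 'o \<Rightarrow> 'o \<Rightarrow> 'm"  \<comment> \<open>\<open>(a \<box> b) \<box> c \<rightarrow> a \<box> (b \<box> c)\<close>\<close>
  lunit :: "'o \<Rightarrow> 'm"  \<comment> \<open>\<open>tens_unit \<box> a \<rightarrow> a\<close>\<close>
  runit :: "'o \<Rightarrow> 'm"  \<comment> \<open>\<open>a \<box> tens_unit \<rightarrow> a\<close>\<close>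
  braid :: "'o \<Rightarrow> 'o \<Rightarrow> 'm"  \<comment> \<open>\<open>a \<box> b \<rightarrow> b \<box> a\<close>\<close>

locale symmetric_monoidal_category = category C
  for C :: "('o, 'm) cat" (structure) +
  fixes T :: "('o, 'm) sym_monoidal" (structure)
  assumes tens_ob_Obj: "\<lbrakk>a \<in> Obj C; b \<in> Obj C\<rbrakk> \<Longrightarrow> a \<box>\<^bsub>T\<^esub> b \<in> Obj C"
    and tens_ar_Hom: "\<lbrakk>f \<in> Hom C a b; f' \<in> Hom C a' b'\<rbrakk>
      \<Longrightarrow> f \<boxtimes>\<^bsub>T\<^esub> f' \<in> Hom C (a \<box>\<^bsub>T\<^esub> a') (b \<box>\<^bsub>T\<^esub> b')"
    and tens_Ident: "\<lbrakk>a \<in> Obj C; b \<in> Obj C\<rbrakk> \<Longrightarrow> Ident C a \<boxtimes>\<^bsub>T\<^esub> Ident C b = Ident C (a \<box>\<^bsub>T\<^esub> b)"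
    and tens_Comp: "\<lbrakk>f \<in> Hom C a b; g \<in> Hom C b c; f' \<in> Hom C a' b'; g' \<in> Hom C b' c'\<rbrakk>
      \<Longrightarrow> (g \<cdot> f) \<boxtimes>\<^bsub>T\<^esub> (g' \<cdot> f') = (g \<boxtimes>\<^bsub>T\<^esub> g') \<cdot> (f \<boxtimes>\<^bsub>T\<^esub> f')"
    and unit_Obj: "tens_unit T \<in> Obj C"
    and assoc_Hom: "\<lbrakk>a \<in> Obj C; b \<in> Obj C; c \<in> Obj C\<rbrakk>
      \<Longrightarrow> assoc T a b c \<in> Hom C (a \<box>\<^bsub>T\<^esub> b \<box>\<^bsub>T\<^esub> c) (a \<box>\<^bsub>T\<^esub> (b \<box>\<^bsub>T\<^esub> c)) \<and> iso_arr C (assoc T a b c)"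
    and lunit_Hom: "a \<in> Obj C \<Longrightarrow> lunit T a \<in> Hom C (tens_unit T \<box>\<^bsub>T\<^esub> a) a \<and> iso_arr C (lunit T a)"
    and runit_Hom: "a \<in> Obj C \<Longrightarrow> runit T a \<in> Hom C (a \<box>\<^bsub>T\<^esub> tens_unit T) a \<and> iso_arr C (runit T a)"
    and braid_Hom: "\<lbrakk>a \<in> Obj C; b \<in> Obj C\<rbrakk> \<Longrightarrow> braid T a b \<in> Hom C (a \<box>\<^bsub>T\<^esub> b) (b \<box>\<^bsub>T\<^esub> a)"
    and assoc_natural: "\<lbrakk>f \<in> Hom C a a'; g \<in> Hom C b b'; h \<in> Hom C c c'\<rbrakk>
      \<Longrightarrow> assoc T a' b' c' \<cdot> (f \<boxtimes>\<^bsub>T\<^esub> g \<boxtimes>\<^bsub>T\<^esub> h) = (f \<boxtimes>\<^bsub>T\<^esub> (g \<boxtimes>\<^bsub>T\<^esub> h)) \<cdot> assoc T a b c"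
    and lunit_natural: "f \<in> Hom C a a'
      \<Longrightarrow> lunit T a' \<cdot> (Ident C (tens_unit T) \<boxtimes>\<^bsub>T\<^esub> f) = f \<cdot> lunit T a"
    and runit_natural: "f \<in> Hom C a a'
      \<Longrightarrow> runit T a' \<cdot> (f \<boxtimes>\<^bsub>T\<^esub> Ident C (tens_unit T)) = f \<cdot> runit T a"
    and braid_natural: "\<lbrakk>f \<in> Hom C a a'; g \<in> Hom C b b'\<rbrakk>
      \<Longrightarrow> braid T a' b' \<cdot> (f \<boxtimes>\<^bsub>T\<^esub> g) = (g \<boxtimes>\<^bsub>T\<^esub> f) \<cdot> braid T a b"
    and pentagon: "\<lbrakk>a \<in> Obj C; b \<in> Obj C; c \<in> Obj C; d \<in> Obj C\<rbrakk>
      \<Longrightarrow> assoc T a b (c \<box>\<^bsub>T\<^esub> d) \<cdot> assoc T (a \<box>\<^bsub>T\<^esub> b) c d =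
        (Ident C a \<boxtimes>\<^bsub>T\<^esub> assoc T b c d) \<cdot> assoc T a (b \<box>\<^bsub>T\<^esub> c) d \<cdot> (assoc T a b c \<boxtimes>\<^bsub>T\<^esub> Ident C d)"
    and triangle: "\<lbrakk>a \<in> Obj C; b \<in> Obj C\<rbrakk>
      \<Longrightarrow> (Ident C a \<boxtimes>\<^bsub>T\<^esub> lunit T b) \<cdot> assoc T a (tens_unit T) b = runit T a \<boxtimes>\<^bsub>T\<^esub> Ident C b"
    and hexagon: "\<lbrakk>a \<in> Obj C; b \<in> Obj C; c \<in> Obj C\<rbrakk>
      \<Longrightarrow> assoc T b c a \<cdot> braid T a (b \<box>\<^bsub>T\<^esub> c) \<cdot> assoc T a b c =
        (Ident C b \<boxtimes>\<^bsub>T\<^esub> braid T a c) \<cdot> assoc T b a c \<cdot> (braid T a b \<boxtimes>\<^bsub>T\<^esub> Ident C c)"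
    and symmetry: "\<lbrakk>a \<in> Obj C; b \<in> Obj C\<rbrakk> \<Longrightarrow> braid T b a \<cdot> braid T a b = Ident C (a \<box>\<^bsub>T\<^esub> b)"

text \<open>\<open>D\<close> is the category in which limits, colimits and images are taken: \<open>C\<close> itself in the first
  case, the ambient bicomplete category in the second.\<close>
definition standing_assumptions ::
  "'u itself \<Rightarrow> ('o, 'm) cat \<Rightarrow> ('o, 'm) sym_monoidal \<Rightarrow> ('o, 'm) cat \<Rightarrow> bool" where
  "standing_assumptions U C T D \<longleftrightarrow> symmetric_monoidal_category C T \<and> essentially_small U C \<and>
     ((D = C \<and> bicomplete U C \<and> (\<forall>f \<in> Arr C. \<exists>g h. image_factorization C f g h)) \<or>
      (category D \<and> full_subcategory C D \<and> bicomplete U D \<and>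
       (\<forall>f \<in> Arr D. \<exists>g h. image_factorization D f g h \<and> epic D g) \<and>
       (\<forall>h. monic D h \<and> Cod D h \<in> Obj C \<longrightarrow> Dom D h \<in> Obj C) \<and>
       (\<forall>g. epic D g \<and> Dom D g \<in> Obj C \<longrightarrow> Cod D g \<in> Obj C)))"


section \<open>Isomorphism classes and group completion\<close>

definition iso_class :: "('o, 'm) cat \<Rightarrow> 'o \<Rightarrow> 'o set" where
  "iso_class C a = {b. isomorphic C a b}"

definition iso_monoid :: "('o, 'm) cat \<Rightarrow> ('o, 'm) sym_monoidal \<Rightarrow> 'o set monoid" where
  "iso_monoid C T =
     \<lparr>carrier = iso_class C ` Obj C,
      mult = (\<lambda>X Y. \<Union>a\<in>X. \<Union>b\<in>Y. iso_class C (a \<box>\<^bsub>T\<^esub> b)),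
      one = iso_class C (tens_unit T)\<rparr>"

context category
begin

lemma isomorphic_refl: "a \<in> Obj C \<Longrightarrow> isomorphic C a a"
  using Ident_Hom[of a] Comp_Ident[of "Ident C a" a a]
  by (auto simp: isomorphic_def iso_arr_def Hom_def)

lemma isomorphicE:
  assumes "isomorphic C a b"
  obtains f g where "f \<in> Hom C a b" "g \<in> Hom C b a" "g \<cdot> f = Ident C a" "f \<cdot> g = Ident C b"
proof -
  obtain f where f: "f \<in> Hom C a b" "iso_arr C f"
    using assms by (auto simp: isomorphic_def)
  then have "Dom C f = a" "Cod C f = b"
    by (simp_all add: Hom_def)
  with f that show thesis
    by (auto simp: iso_arr_def)
qed

lemma isomorphicI:
  assumes "a \<in> Obj C" "b \<in> Obj C"
    and "f \<in> Hom C a b" "g \<in> Hom C b a" "g \<cdot> f = Ident C a" "f \<cdot> g = Ident C b"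
  shows "isomorphic C a b"
proof -
  have "f \<in> Arr C" "Dom C f = a" "Cod C f = b"
    using assms(3) by (simp_all add: Hom_def)
  then have "iso_arr C f"
    using assms(4-6) by (auto simp: iso_arr_def)
  with assms(1-3) show ?thesis
    by (auto simp: isomorphic_def)
qed

lemma isomorphic_sym:
  assumes "isomorphic C a b"
  shows "isomorphic C b a"
  using assms
proof (rule isomorphicE)
  fix f g
  assume "f \<in> Hom C a b" "g \<in> Hom C b a" "g \<cdot> f = Ident C a" "f \<cdot> g = Ident C b"
  then show ?thesis
    using assms by (intro isomorphicI[of b a g f]) (simp_all add: isomorphic_def)
qed

lemma isomorphic_trans:
  assumes "isomorphic C a b" "isomorphic C b c"
  shows "isomorphic C a c"
proof -
  obtain f f' where f: "f \<in> Hom C a b" "f' \<in> Hom C b a" "f' \<cdot> f = Ident C a" "f \<cdot> f' = Ident C b"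
    using assms(1) by (rule isomorphicE)
  obtain g g' where g: "g \<in> Hom C b c" "g' \<in> Hom C c b" "g' \<cdot> g = Ident C b" "g \<cdot> g' = Ident C c"
    using assms(2) by (rule isomorphicE)
  show ?thesis
  proof (rule isomorphicI)
    show "a \<in> Obj C" "c \<in> Obj C"
      using assms by (auto simp: isomorphic_def)
    show "g \<cdot> f \<in> Hom C a c" "f' \<cdot> g' \<in> Hom C c a"
      using f g Comp_Hom by blast+
    have "f' \<cdot> g' \<cdot> (g \<cdot> f) = f' \<cdot> (g' \<cdot> g \<cdot> f)"
      using Comp_assoc[OF Comp_Hom[OF f(1) g(1)] g(2) f(2)] Comp_assoc[OF f(1) g(1) g(2)] by simp
    then show "f' \<cdot> g' \<cdot> (g \<cdot> f) = Ident C a"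
      using f g Ident_Comp by simp
    have "g \<cdot> f \<cdot> (f' \<cdot> g') = g \<cdot> (f \<cdot> f' \<cdot> g')"
      using Comp_assoc[OF Comp_Hom[OF g(2) f(2)] f(1) g(1)] Comp_assoc[OF g(2) f(2) f(1)] by simp
    then show "g \<cdot> f \<cdot> (f' \<cdot> g') = Ident C c"
      using f g Ident_Comp by simp
  qed
qed

lemma iso_class_eqI: "isomorphic C a b \<Longrightarrow> iso_class C a = iso_class C b"
  unfolding iso_class_def by (blast intro: isomorphic_sym isomorphic_trans)

end

context symmetric_monoidal_category
begin

lemma iso_arr_tens:
  assumes "f \<in> Hom C a b" "iso_arr C f" "f' \<in> Hom C a' b'" "iso_arr C f'"
  shows "iso_arr C (f \<boxtimes>\<^bsub>T\<^esub> f')"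
proof -
  have D: "Dom C f = a" "Cod C f = b" "Dom C f' = a'" "Cod C f' = b'" "f \<in> Arr C" "f' \<in> Arr C"
    using assms by (auto simp: Hom_def)
  then have O: "a \<in> Obj C" "b \<in> Obj C" "a' \<in> Obj C" "b' \<in> Obj C"
    using Dom_Obj Cod_Obj by blast+
  obtain g where g: "g \<in> Hom C b a" "g \<cdot> f = Ident C a" "f \<cdot> g = Ident C b"
    using assms(2) D by (auto simp: iso_arr_def)
  obtain g' where g': "g' \<in> Hom C b' a'" "g' \<cdot> f' = Ident C a'" "f' \<cdot> g' = Ident C b'"
    using assms(4) D by (auto simp: iso_arr_def)
  have "(g \<boxtimes>\<^bsub>T\<^esub> g') \<cdot> (f \<boxtimes>\<^bsub>T\<^esub> f') = Ident C (a \<box>\<^bsub>T\<^esub> a')"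
    using tens_Comp[OF assms(1) g(1) assms(3) g'(1)] g g' tens_Ident O by simp
  moreover have "(f \<boxtimes>\<^bsub>T\<^esub> f') \<cdot> (g \<boxtimes>\<^bsub>T\<^esub> g') = Ident C (b \<box>\<^bsub>T\<^esub> b')"
    using tens_Comp[OF g(1) assms(1) g'(1) assms(3)] g g' tens_Ident O by simp
  moreover have "g \<boxtimes>\<^bsub>T\<^esub> g' \<in> Hom C (b \<box>\<^bsub>T\<^esub> b') (a \<box>\<^bsub>T\<^esub> a')"
    using tens_ar_Hom[OF g(1) g'(1)] .
  moreover have "f \<boxtimes>\<^bsub>T\<^esub> f' \<in> Arr C" "Dom C (f \<boxtimes>\<^bsub>T\<^esub> f') = a \<box>\<^bsub>T\<^esub> a'"
      "Cod C (f \<boxtimes>\<^bsub>T\<^esub> f') = b \<box>\<^bsub>T\<^esub> b'"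
    using tens_ar_Hom[OF assms(1,3)] by (simp_all add: Hom_def)
  ultimately show ?thesis
    by (auto simp: iso_arr_def)
qed

lemma isomorphic_tens:
  "isomorphic C a b \<Longrightarrow> isomorphic C a' b' \<Longrightarrow> isomorphic C (a \<box>\<^bsub>T\<^esub> a') (b \<box>\<^bsub>T\<^esub> b')"
  unfolding isomorphic_def using iso_arr_tens tens_ob_Obj tens_ar_Hom by meson

lemma iso_class_tens:
  assumes "a \<in> Obj C" "b \<in> Obj C"
  shows "iso_class C a \<otimes>\<^bsub>iso_monoid C T\<^esub> iso_class C b = iso_class C (a \<box>\<^bsub>T\<^esub> b)"
proof -
  have eq: "iso_class C (x \<box>\<^bsub>T\<^esub> y) = iso_class C (a \<box>\<^bsub>T\<^esub> b)" if "x \<in> iso_class C a" "y \<in> iso_class C b" for x y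
    using that iso_class_eqI[OF isomorphic_tens, of a x b y] by (simp add: iso_class_def)
  have mem: "a \<in> iso_class C a" "b \<in> iso_class C b"
    using assms by (simp_all add: iso_class_def isomorphic_refl)
  have "(\<Union>x\<in>iso_class C a. \<Union>y\<in>iso_class C b. iso_class C (x \<box>\<^bsub>T\<^esub> y)) =
      (\<Union>x\<in>iso_class C a. \<Union>y\<in>iso_class C b. iso_class C (a \<box>\<^bsub>T\<^esub> b))"
    by (intro SUP_cong refl eq)
  also have "\<dots> = iso_class C (a \<box>\<^bsub>T\<^esub> b)"
    using mem by (metis UN_constant empty_iff)
  finally show ?thesis
    by (simp add: iso_monoid_def)
qed

lemma comm_monoid_iso_monoid: "comm_monoid (iso_monoid C T)"
proof (rule comm_monoidI)
  fix X Y Z assume XYZ: "X \<in> carrier (iso_monoid C T)" "Y \<in> carrier (iso_monoid C T)"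
  obtain a b where ab: "a \<in> Obj C" "b \<in> Obj C" "X = iso_class C a" "Y = iso_class C b"
    using XYZ by (auto simp: iso_monoid_def)
  show "X \<otimes>\<^bsub>iso_monoid C T\<^esub> Y \<in> carrier (iso_monoid C T)"
    using ab by (simp add: iso_class_tens) (simp add: iso_monoid_def tens_ob_Obj)
  have "isomorphic C (a \<box>\<^bsub>T\<^esub> b) (b \<box>\<^bsub>T\<^esub> a)"
    using ab by (intro isomorphicI[OF _ _ braid_Hom braid_Hom symmetry symmetry] tens_ob_Obj)
  then show "X \<otimes>\<^bsub>iso_monoid C T\<^esub> Y = Y \<otimes>\<^bsub>iso_monoid C T\<^esub> X"
    using ab by (simp add: iso_class_tens iso_class_eqI)
next
  show "\<one>\<^bsub>iso_monoid C T\<^esub> \<in> carrier (iso_monoid C T)"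
    by (simp add: iso_monoid_def unit_Obj)
next
  fix X assume "X \<in> carrier (iso_monoid C T)"
  then obtain a where a: "a \<in> Obj C" "X = iso_class C a" by (auto simp: iso_monoid_def)
  have "isomorphic C (tens_unit T \<box>\<^bsub>T\<^esub> a) a"
    unfolding isomorphic_def using a(1) lunit_Hom[of a] tens_ob_Obj[OF unit_Obj a(1)] by blast
  moreover have "\<one>\<^bsub>iso_monoid C T\<^esub> = iso_class C (tens_unit T)"
    by (simp add: iso_monoid_def)
  ultimately show "\<one>\<^bsub>iso_monoid C T\<^esub> \<otimes>\<^bsub>iso_monoid C T\<^esub> X = X"
    using a by (simp add: iso_class_tens iso_class_eqI unit_Obj)
next
  fix X Y Z
  assume XYZ: "X \<in> carrier (iso_monoid C T)" "Y \<in> carrier (iso_monoid C T)" "Z \<in> carrier (iso_monoid C T)"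
  obtain a b c where abc: "a \<in> Obj C" "b \<in> Obj C" "c \<in> Obj C"
      "X = iso_class C a" "Y = iso_class C b" "Z = iso_class C c"
    using XYZ by (auto simp: iso_monoid_def)
  have "isomorphic C (a \<box>\<^bsub>T\<^esub> b \<box>\<^bsub>T\<^esub> c) (a \<box>\<^bsub>T\<^esub> (b \<box>\<^bsub>T\<^esub> c))"
    unfolding isomorphic_def using assoc_Hom[OF abc(1-3)]
    by (intro conjI tens_ob_Obj abc(1-3)) blast
  then show "X \<otimes>\<^bsub>iso_monoid C T\<^esub> Y \<otimes>\<^bsub>iso_monoid C T\<^esub> Z = X \<otimes>\<^bsub>iso_monoid C T\<^esub> (Y \<otimes>\<^bsub>iso_monoid C T\<^esub> Z)"
    using abc by (simp add: iso_class_tens iso_class_eqI tens_ob_Obj)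
qed

end

text \<open>A pair \<open>(a, b)\<close> represents the formal difference of \<open>a\<close> and \<open>b\<close>. As usual in
  HOL-Algebra, commutative monoids and groups are written multiplicatively.\<close>

definition completion_rel :: "('a, 'b) monoid_scheme \<Rightarrow> ('a \<times> 'a) rel" where
  "completion_rel M = {((a, b), (c, d)). a \<in> carrier M \<and> b \<in> carrier M \<and> c \<in> carrier M \<and> d \<in> carrier M \<and>
     (\<exists>k \<in> carrier M. a \<otimes>\<^bsub>M\<^esub> d \<otimes>\<^bsub>M\<^esub> k = c \<otimes>\<^bsub>M\<^esub> b \<otimes>\<^bsub>M\<^esub> k)}"

definition group_completion :: "('a, 'b) monoid_scheme \<Rightarrow> ('a \<times> 'a) set monoid" where
  "group_completion M =
     \<lparr>carrier = (carrier M \<times> carrier M) // completion_rel M,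
      mult = (\<lambda>X Y. \<Union>(a, b)\<in>X. \<Union>(c, d)\<in>Y. completion_rel M `` {(a \<otimes>\<^bsub>M\<^esub> c, b \<otimes>\<^bsub>M\<^esub> d)}),
      one = completion_rel M `` {(\<one>\<^bsub>M\<^esub>, \<one>\<^bsub>M\<^esub>)}\<rparr>"

definition completion_map :: "('a, 'b) monoid_scheme \<Rightarrow> 'a \<Rightarrow> ('a \<times> 'a) set" where
  "completion_map M a = completion_rel M `` {(a, \<one>\<^bsub>M\<^esub>)}"

context comm_monoid
begin

lemma equiv_completion_rel: "equiv (carrier G \<times> carrier G) (completion_rel G)"
proof (rule equivI)
  show "completion_rel G \<subseteq> (carrier G \<times> carrier G) \<times> carrier G \<times> carrier G"
    by (auto simp: completion_rel_def)
  show "refl_on (carrier G \<times> carrier G) (completion_rel G)"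
    by (auto simp: refl_on_def completion_rel_def)
  show "sym (completion_rel G)"
    by (rule symI) (auto simp: completion_rel_def, metis)
  show "trans (completion_rel G)"
  proof (rule transI, clarify)
    fix a b c d e f
    assume "((a, b), (c, d)) \<in> completion_rel G" "((c, d), (e, f)) \<in> completion_rel G"
    then obtain k l where H: "a \<in> carrier G" "b \<in> carrier G" "c \<in> carrier G" "d \<in> carrier G"
        "e \<in> carrier G" "f \<in> carrier G" "k \<in> carrier G" "l \<in> carrier G"
        "a \<otimes> d \<otimes> k = c \<otimes> b \<otimes> k" "c \<otimes> f \<otimes> l = e \<otimes> d \<otimes> l"
      by (auto simp: completion_rel_def)
    have "a \<otimes> f \<otimes> (d \<otimes> k \<otimes> l) = (a \<otimes> d \<otimes> k) \<otimes> (f \<otimes> l)"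
      using H(1-8) by (simp add: m_ac)
    also have "\<dots> = (c \<otimes> f \<otimes> l) \<otimes> (b \<otimes> k)"
      unfolding H(9) using H(1-8) by (simp add: m_ac)
    also have "\<dots> = e \<otimes> b \<otimes> (d \<otimes> k \<otimes> l)"
      unfolding H(10) using H(1-8) by (simp add: m_ac)
    finally have "a \<otimes> f \<otimes> (d \<otimes> k \<otimes> l) = e \<otimes> b \<otimes> (d \<otimes> k \<otimes> l)" .
    then show "((a, b), (e, f)) \<in> completion_rel G"
      using H(1-8) by (auto simp: completion_rel_def intro!: bexI[of _ "d \<otimes> k \<otimes> l"])
  qed
qed

lemma completion_rel_mult:
  assumes "((a, b), (a', b')) \<in> completion_rel G" "((c, d), (c', d')) \<in> completion_rel G"
  shows "((a \<otimes> c, b \<otimes> d), (a' \<otimes> c', b' \<otimes> d')) \<in> completion_rel G"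
proof -
  obtain k l where H: "a \<in> carrier G" "b \<in> carrier G" "a' \<in> carrier G" "b' \<in> carrier G"
      "c \<in> carrier G" "d \<in> carrier G" "c' \<in> carrier G" "d' \<in> carrier G" "k \<in> carrier G" "l \<in> carrier G"
      "a \<otimes> b' \<otimes> k = a' \<otimes> b \<otimes> k" "c \<otimes> d' \<otimes> l = c' \<otimes> d \<otimes> l"
    using assms by (auto simp: completion_rel_def)
  have "a \<otimes> c \<otimes> (b' \<otimes> d') \<otimes> (k \<otimes> l) = (a \<otimes> b' \<otimes> k) \<otimes> (c \<otimes> d' \<otimes> l)"
    using H(1-10) by (simp add: m_ac)
  also have "\<dots> = a' \<otimes> c' \<otimes> (b \<otimes> d) \<otimes> (k \<otimes> l)"
    unfolding H(11,12) using H(1-10) by (simp add: m_ac)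
  finally show ?thesis
    using H(1-10) by (auto simp: completion_rel_def intro!: bexI[of _ "k \<otimes> l"])
qed

lemma group_completion_mult:
  assumes "a \<in> carrier G" "b \<in> carrier G" "c \<in> carrier G" "d \<in> carrier G"
  shows "completion_rel G `` {(a, b)} \<otimes>\<^bsub>group_completion G\<^esub> completion_rel G `` {(c, d)} =
    completion_rel G `` {(a \<otimes> c, b \<otimes> d)}"
proof -
  let ?K = "completion_rel G `` {(a \<otimes> c, b \<otimes> d)}"
  have eq: "completion_rel G `` {(x \<otimes> z, y \<otimes> w)} = ?K"
    if "(x, y) \<in> completion_rel G `` {(a, b)}" "(z, w) \<in> completion_rel G `` {(c, d)}" for x y z w
    using equiv_class_eq[OF equiv_completion_rel completion_rel_mult, of a b x y c d z w] that by simp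
  have mem: "(a, b) \<in> completion_rel G `` {(a, b)}" "(c, d) \<in> completion_rel G `` {(c, d)}"
    using assms by (auto simp: completion_rel_def)
  have "(\<Union>(x, y)\<in>completion_rel G `` {(a, b)}. \<Union>(z, w)\<in>completion_rel G `` {(c, d)}.
           completion_rel G `` {(x \<otimes> z, y \<otimes> w)}) =
      (\<Union>(x, y)\<in>completion_rel G `` {(a, b)}. \<Union>(z, w)\<in>completion_rel G `` {(c, d)}. ?K)"
    by (intro SUP_cong refl) (simp only: case_prod_unfold, intro SUP_cong refl, simp add: eq)
  also have "\<dots> = ?K"
    using mem by (simp only: case_prod_unfold) (metis UN_constant empty_iff)
  finally show ?thesis
    by (simp add: group_completion_def)
qed

lemma group_completion_carrierE:
  assumes "X \<in> carrier (group_completion G)"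
  obtains a b where "a \<in> carrier G" "b \<in> carrier G" "X = completion_rel G `` {(a, b)}"
  using assms by (auto simp: group_completion_def quotient_def)

lemma completion_class_closed:
  "\<lbrakk>a \<in> carrier G; b \<in> carrier G\<rbrakk> \<Longrightarrow> completion_rel G `` {(a, b)} \<in> carrier (group_completion G)"
  by (auto simp: group_completion_def quotient_def)

lemma comm_group_group_completion: "comm_group (group_completion G)"
proof (rule comm_groupI)
  fix X Y Z
  assume X: "X \<in> carrier (group_completion G)" and Y: "Y \<in> carrier (group_completion G)"
    and Z: "Z \<in> carrier (group_completion G)"
  show "X \<otimes>\<^bsub>group_completion G\<^esub> Y \<otimes>\<^bsub>group_completion G\<^esub> Z =
      X \<otimes>\<^bsub>group_completion G\<^esub> (Y \<otimes>\<^bsub>group_completion G\<^esub> Z)"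
    using X Y Z by (elim group_completion_carrierE) (simp add: group_completion_mult m_assoc)
next
  fix X Y
  assume X: "X \<in> carrier (group_completion G)" and Y: "Y \<in> carrier (group_completion G)"
  show "X \<otimes>\<^bsub>group_completion G\<^esub> Y \<in> carrier (group_completion G)"
    using X Y by (elim group_completion_carrierE) (simp add: group_completion_mult completion_class_closed)
  show "X \<otimes>\<^bsub>group_completion G\<^esub> Y = Y \<otimes>\<^bsub>group_completion G\<^esub> X"
    using X Y by (elim group_completion_carrierE) (simp add: group_completion_mult m_comm)
next
  have one: "\<one>\<^bsub>group_completion G\<^esub> = completion_rel G `` {(\<one>, \<one>)}"
    by (simp add: group_completion_def)
  then show "\<one>\<^bsub>group_completion G\<^esub> \<in> carrier (group_completion G)"
    by (simp add: completion_class_closed)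
  fix X
  assume "X \<in> carrier (group_completion G)"
  then obtain a b where ab: "a \<in> carrier G" "b \<in> carrier G" "X = completion_rel G `` {(a, b)}"
    by (rule group_completion_carrierE)
  show "\<one>\<^bsub>group_completion G\<^esub> \<otimes>\<^bsub>group_completion G\<^esub> X = X"
    using ab by (simp add: one group_completion_mult)
  have "((b \<otimes> a, a \<otimes> b), (\<one>, \<one>)) \<in> completion_rel G"
    using ab by (auto simp: completion_rel_def m_comm)
  then have "completion_rel G `` {(b, a)} \<otimes>\<^bsub>group_completion G\<^esub> X = \<one>\<^bsub>group_completion G\<^esub>"
    using ab one group_completion_mult equiv_class_eq[OF equiv_completion_rel] by simp
  then show "\<exists>Y \<in> carrier (group_completion G). Y \<otimes>\<^bsub>group_completion G\<^esub> X = \<one>\<^bsub>group_completion G\<^esub>"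
    using ab completion_class_closed by blast
qed

lemma completion_map_hom: "completion_map G \<in> hom G (group_completion G)"
  by (rule homI) (simp_all add: completion_map_def completion_class_closed group_completion_mult)

end


section \<open>Posets\<close>

text \<open>A poset is a pair \<open>P\<close>, \<open>r\<close> with \<^term>\<open>partial_order_on P r\<close>, where \<open>(p, q) \<in> r\<close> means
  \<open>p \<le> q\<close>.\<close>

text \<open>For \<open>I \<subseteq> P\<close> this is the subposet \<open>I\<close> of \<open>P\<close> as a category; a functor on \<open>P\<close> is restricted to \<open>I\<close>
  simply by changing its index category.\<close>
definition poset_cat :: "'p set \<Rightarrow> 'p rel \<Rightarrow> ('p, 'p \<times> 'p) cat" where
  "poset_cat I r =
     \<lparr>Obj = I, Arr = Restr r I, Dom = fst, Cod = snd, Ident = (\<lambda>p. (p, p)),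
      Comp = (\<lambda>g f. (fst f, snd g))\<rparr>"

lemma category_poset_cat:
  assumes "partial_order_on P r" "I \<subseteq> P"
  shows "category (poset_cat I r)"
proof -
  have "refl_on P r" "trans r"
    using assms(1) by (auto simp: partial_order_on_def preorder_on_def)
  then show ?thesis
    using assms(2) by unfold_locales (auto simp: poset_cat_def Hom_def refl_on_def dest: transD)
qed

definition connected_poset :: "'p set \<Rightarrow> 'p rel \<Rightarrow> bool" where
  "connected_poset P r \<longleftrightarrow> (\<forall>p \<in> P. \<forall>q \<in> P. (p, q) \<in> (Restr (r \<union> r\<inverse>) P)\<^sup>*)"

definition locally_finite :: "'p set \<Rightarrow> 'p rel \<Rightarrow> bool" where
  "locally_finite P r \<longleftrightarrow> (\<forall>p \<in> P. \<forall>q \<in> P. (p, q) \<in> r \<longrightarrow> finite {x \<in> P. (p, x) \<in> r \<and> (x, q) \<in> r})"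

definition covers :: "'p set \<Rightarrow> 'p rel \<Rightarrow> 'p \<Rightarrow> 'p \<Rightarrow> bool" where
  "covers P r q p \<longleftrightarrow> p \<in> P \<and> q \<in> P \<and> (p, q) \<in> r \<and> p \<noteq> q \<and>
     \<not> (\<exists>x \<in> P. (p, x) \<in> r \<and> (x, q) \<in> r \<and> x \<noteq> p \<and> x \<noteq> q)"

definition hasse :: "'p set \<Rightarrow> 'p rel \<Rightarrow> 'p rel" where
  "hasse P r = {(p, q). covers P r p q \<or> covers P r q p}"

definition Con :: "'p set \<Rightarrow> 'p rel \<Rightarrow> 'p set set" where
  "Con P r = {I. I \<subseteq> P \<and> I \<noteq> {} \<and> (\<forall>p \<in> I. \<forall>q \<in> I. (p, q) \<in> (Restr (hasse P r) I)\<^sup>*)}"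

definition con_order :: "'p set \<Rightarrow> 'p rel \<Rightarrow> 'p set rel" where
  "con_order P r = {(I, J). I \<in> Con P r \<and> J \<in> Con P r \<and> I \<subseteq> J}"

definition con_op_order :: "'p set \<Rightarrow> 'p rel \<Rightarrow> 'p set rel" where
  "con_op_order P r = (con_order P r)\<inverse>"

definition nbd :: "'p set \<Rightarrow> 'p rel \<Rightarrow> 'p set \<Rightarrow> 'p set" where
  "nbd P r I = {p \<in> P - I. \<exists>q \<in> I. (q, p) \<in> hasse P r}"

definition essentially_finite :: "'p set \<Rightarrow> 'p rel \<Rightarrow> bool" where
  "essentially_finite P r \<longleftrightarrow> locally_finite P r \<and> (\<forall>I \<in> Con P r. finite (nbd P r I))"

text \<open>The sets \<open>J\<close> between \<open>I\<close> and \<open>I \<union> nbd I\<close> obtained by adding exactly \<open>n\<close> neighbours.\<close>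
definition thickenings :: "'p set \<Rightarrow> 'p rel \<Rightarrow> nat \<Rightarrow> 'p set \<Rightarrow> 'p set set" where
  "thickenings P r n I = {J. I \<subseteq> J \<and> J \<subseteq> I \<union> nbd P r I \<and> card (J \<inter> nbd P r I) = n}"

text \<open>The recursion terminates because of the guard; on posets that are not locally finite the
  function is \<open>0\<close>.\<close>
function moebius :: "'p set \<Rightarrow> 'p rel \<Rightarrow> 'p \<Rightarrow> 'p \<Rightarrow> int" where
  "moebius Q r p q =
     (if partial_order_on Q r \<and> locally_finite Q r \<and> (p, q) \<in> r
      then if p = q then 1 else - (\<Sum>x | x \<in> Q \<and> (p, x) \<in> r \<and> (x, q) \<in> r \<and> x \<noteq> q. moebius Q r p x)
      else 0)"
  by auto
termination
proof (relation "measure (\<lambda>(Q, r, p, q). card {x \<in> Q. (p, x) \<in> r \<and> (x, q) \<in> r})")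
  fix Q :: "'p set" and r p q x
  assume *: "partial_order_on Q r \<and> locally_finite Q r \<and> (p, q) \<in> r" "p \<noteq> q"
    and x: "x \<in> {x. x \<in> Q \<and> (p, x) \<in> r \<and> (x, q) \<in> r \<and> x \<noteq> q}"
  have po: "r \<subseteq> Q \<times> Q" "refl_on Q r" "trans r" "antisym r"
    using * by (auto simp: partial_order_on_def preorder_on_def)
  have "finite {x \<in> Q. (p, x) \<in> r \<and> (x, q) \<in> r}"
    using * po(1) by (auto simp: locally_finite_def)
  moreover have "{y \<in> Q. (p, y) \<in> r \<and> (y, x) \<in> r} \<subseteq> {y \<in> Q. (p, y) \<in> r \<and> (y, q) \<in> r}"
    using x po(3) by (auto dest: transD)
  moreover have "q \<in> {y \<in> Q. (p, y) \<in> r \<and> (y, q) \<in> r}"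
    using * po by (auto simp: refl_on_def)
  moreover have "q \<notin> {y \<in> Q. (p, y) \<in> r \<and> (y, x) \<in> r}"
    using x po(4) by (auto dest: antisymD)
  ultimately have "card {y \<in> Q. (p, y) \<in> r \<and> (y, x) \<in> r} < card {y \<in> Q. (p, y) \<in> r \<and> (y, q) \<in> r}"
    by (metis (no_types, lifting) psubset_card_mono psubsetI)
  then show "((Q, r, p, x), (Q, r, p, q)) \<in> measure (\<lambda>(Q, r, p, q). card {x \<in> Q. (p, x) \<in> r \<and> (x, q) \<in> r})"
    by simp
qed simp

declare moebius.simps [simp del]

abbreviation con_moebius :: "'p set \<Rightarrow> 'p rel \<Rightarrow> 'p set \<Rightarrow> 'p set \<Rightarrow> int" where
  "con_moebius P r \<equiv> moebius (Con P r) (con_op_order P r)"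


section \<open>Rank invariant and persistence diagram\<close>

text \<open>\<open>x\<close> is an image in \<open>D\<close> of the canonical map \<open>\<iota> a \<cdot> \<pi> a\<close> from a limit to a colimit
  of the restriction of \<open>F\<close> to \<open>I\<close>.\<close>
definition rank_object ::
  "('o, 'm) cat \<Rightarrow> 'p rel \<Rightarrow> ('p, 'p \<times> 'p, 'o, 'm) functor_data \<Rightarrow> 'p set \<Rightarrow> 'o \<Rightarrow> bool" where
  "rank_object D r F I x \<longleftrightarrow>
     (\<exists>l \<pi> k \<iota> a g h. limit_cone (poset_cat I r) D F l \<pi> \<and> colimit_cocone (poset_cat I r) D F k \<iota> \<and>
        a \<in> I \<and> image_factorization D (\<iota> a \<cdot>\<^bsub>D\<^esub> \<pi> a) g h \<and> x = Dom D h)"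

definition rank_invariant ::
  "('o, 'm) cat \<Rightarrow> ('o, 'm) cat \<Rightarrow> 'p rel \<Rightarrow> ('p, 'p \<times> 'p, 'o, 'm) functor_data \<Rightarrow> 'p set \<Rightarrow> 'o set" where
  "rank_invariant C D r F I = iso_class C (SOME x. rank_object D r F I x)"

abbreviation completed_iso_monoid ::
  "('o, 'm) cat \<Rightarrow> ('o, 'm) sym_monoidal \<Rightarrow> ('o set \<times> 'o set) set monoid" where
  "completed_iso_monoid C T \<equiv> group_completion (iso_monoid C T)"

text \<open>The rank invariant with values in the group completion.\<close>
definition completed_rank ::
  "('o, 'm) cat \<Rightarrow> ('o, 'm) sym_monoidal \<Rightarrow> ('o, 'm) cat \<Rightarrow> 'p rel \<Rightarrow>
   ('p, 'p \<times> 'p, 'o, 'm) functor_data \<Rightarrow> 'p set \<Rightarrow> ('o set \<times> 'o set) set" where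
  "completed_rank C T D r F I = completion_map (iso_monoid C T) (rank_invariant C D r F I)"

definition persistence_diagram ::
  "('o, 'm) cat \<Rightarrow> ('o, 'm) sym_monoidal \<Rightarrow> ('o, 'm) cat \<Rightarrow> 'p set \<Rightarrow> 'p rel \<Rightarrow>
   ('p, 'p \<times> 'p, 'o, 'm) functor_data \<Rightarrow> 'p set \<Rightarrow> ('o set \<times> 'o set) set" where
  "persistence_diagram C T D P r F I =
     completed_rank C T D r F I \<otimes>\<^bsub>completed_iso_monoid C T\<^esub>
     finprod (completed_iso_monoid C T)
       (\<lambda>n. finprod (completed_iso_monoid C T) (completed_rank C T D r F) (thickenings P r n I)
              [^]\<^bsub>completed_iso_monoid C T\<^esub> ((- 1) ^ n :: int))
       {1..card (nbd P r I)}"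

end

theory Submission
  imports Defs
begin

text \<open>The point is an explicit Moebius function: \<open>\<mu>(J, I) = (-1)^|J - I|\<close> if
  \<open>I \<subseteq> J \<subseteq> I \<union> nbd I\<close>, and \<open>0\<close> otherwise. Indeed, call the right-hand side \<open>g(J, I)\<close>. For
  connected \<open>X \<supset> I\<close> the sum of \<open>g(K, I)\<close> over \<open>I \<subseteq> K \<subseteq> X\<close> is the alternating sum over all subsets
  of \<open>X \<inter> nbd I\<close>, which vanishes because a connected \<open>X\<close> properly containing \<open>I\<close> meets \<open>nbd I\<close>.
  So \<open>g\<close> is a right inverse of the zeta function in the incidence algebra and therefore equals \<open>\<mu>\<close>.
  Collecting the \<open>J\<close> with \<open>\<mu>(J, I) \<noteq> 0\<close> by \<open>|J - I|\<close> gives the defining sum of the diagram. The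
  categorical hypotheses only serve to show that all ranks lie in \<open>\<I>(C)\<close>.\<close>


section \<open>The Moebius function of connected subsets\<close>

lemma sum_Pow_alternating:
  assumes "finite A" "A \<noteq> {}"
  shows "(\<Sum>S\<in>Pow A. (- 1) ^ card S :: int) = 0"
proof -
  \<comment> \<open>Expanding this product gives the alternating sum, while its factors are all 0
    and \<open>A\<close> is nonempty.\<close>
  have "(\<Prod>i\<in>A. - 1 + 1 :: int) = (\<Sum>S\<in>Pow A. (\<Prod>i\<in>S. - 1) * (\<Prod>i\<in>A - S. 1))"
    by (rule prod_add) (fact assms)
  then show ?thesis
    using assms by (simp add: card_gt_0_iff zero_power)
qed

text \<open>A right inverse of the zeta function, such as \<open>g\<close>, agrees with its left inverse \<open>moebius\<close>.\<close>
lemma moebius_eqI: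
  assumes po: "partial_order_on Q r" and lf: "locally_finite Q r" and pq: "(p, q) \<in> r"
    and g: "\<And>x. \<lbrakk>(p, x) \<in> r; (x, q) \<in> r\<rbrakk> \<Longrightarrow>
      (\<Sum>y | y \<in> Q \<and> (x, y) \<in> r \<and> (y, q) \<in> r. g y) = (if x = q then 1 else 0)"
  shows "moebius Q r p q = g p"
proof -
  have rQ: "r \<subseteq> Q \<times> Q" and refl: "refl_on Q r" and tr: "trans r" and anti: "antisym r"
    using po by (auto simp: partial_order_on_def preorder_on_def)
  let ?B = "{x \<in> Q. (p, x) \<in> r \<and> (x, q) \<in> r}"
  have p: "p \<in> Q" "(p, p) \<in> r" and q: "q \<in> Q" "(q, q) \<in> r"
    using pq rQ refl by (auto simp: refl_on_def)
  have fin: "finite {x \<in> Q. (a, x) \<in> r \<and> (x, b) \<in> r}" if "(a, b) \<in> r" for a b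
    using lf rQ that by (auto simp: locally_finite_def)
  \<comment> \<open>The defining recursion, with the top term \<open>y\<close> moved back into the
    sum, says that \<open>moebius\<close> is a left inverse of the zeta function.\<close>
  have left: "(\<Sum>x | x \<in> Q \<and> (p, x) \<in> r \<and> (x, y) \<in> r. moebius Q r p x) = (if y = p then 1 else 0)"
    if y: "(p, y) \<in> r" for y
  proof (cases "y = p")
    case True
    then have "{x \<in> Q. (p, x) \<in> r \<and> (x, y) \<in> r} = {p}"
      using p anti by (auto dest: antisymD)
    then show ?thesis
      using True p po lf by (simp add: moebius.simps[of Q r p p])
  next
    case False
    have "y \<in> Q" "(y, y) \<in> r"
      using y rQ refl by (auto simp: refl_on_def)
    then have "{x \<in> Q. (p, x) \<in> r \<and> (x, y) \<in> r} =
        insert y {x \<in> Q. (p, x) \<in> r \<and> (x, y) \<in> r \<and> x \<noteq> y}" (is "_ = insert y ?S")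
      using y by auto
    moreover have "finite ?S"
      by (rule finite_subset[OF _ fin[OF y]]) auto
    ultimately show ?thesis
      using False y po lf by (simp add: moebius.simps[of Q r p y])
  qed
  \<comment> \<open>Here and in \<open>outer\<close> the summation set is rewritten as a part of the
    fixed finite interval \<open>?B\<close>, the form in which the two sums can be
    exchanged.\<close>
  have inner: "(\<Sum>y | y \<in> ?B \<and> (x, y) \<in> r. g y) = (if x = q then 1 else 0)" if "x \<in> ?B" for x
  proof -
    have "{y. y \<in> ?B \<and> (x, y) \<in> r} = {y. y \<in> Q \<and> (x, y) \<in> r \<and> (y, q) \<in> r}"
      using that tr by (auto dest: transD)
    then show ?thesis
      using g that by simp
  qed
  have outer: "(\<Sum>x | x \<in> ?B \<and> (x, y) \<in> r. moebius Q r p x) = (if y = p then 1 else 0)" if "y \<in> ?B" for y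
  proof -
    have "{x. x \<in> ?B \<and> (x, y) \<in> r} = {x. x \<in> Q \<and> (p, x) \<in> r \<and> (x, y) \<in> r}"
      using that tr by (auto dest: transD)
    then show ?thesis
      using left that by simp
  qed
  \<comment> \<open>Associativity of convolution by hand: the sum of
    \<open>moebius Q r p x * g y\<close> over all x below y in \<open>?B\<close> is evaluated first
    over y, then over x.\<close>
  have "moebius Q r p q = (\<Sum>x\<in>?B. moebius Q r p x * (if x = q then 1 else 0))"
    using pq q fin[OF pq] by (simp add: if_distrib cong: if_cong)
  also have "\<dots> = (\<Sum>x\<in>?B. \<Sum>y | y \<in> ?B \<and> (x, y) \<in> r. moebius Q r p x * g y)"
    using inner by (simp add: sum_distrib_left[symmetric])
  also have "\<dots> = (\<Sum>y\<in>?B. \<Sum>x | x \<in> ?B \<and> (x, y) \<in> r. moebius Q r p x * g y)"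
    by (rule sum.swap_restrict) (use fin[OF pq] in auto)
  also have "\<dots> = (\<Sum>y\<in>?B. (if y = p then 1 else 0) * g y)"
    using outer by (simp add: sum_distrib_right[symmetric])
  also have "\<dots> = g p"
    using pq p fin[OF pq] by (simp add: if_distrib[of "\<lambda>z. z * _"] cong: if_cong)
  finally show ?thesis .
qed

section \<open>Connected subsets and their neighbours\<close>

lemma partial_order_con_op: "partial_order_on (Con P r) (con_op_order P r)"
  by (auto simp: partial_order_on_def preorder_on_def refl_on_def con_op_order_def con_order_def
      intro!: transI antisymI)

lemma locally_finite_con_op:
  "locally_finite (Con P r) (con_order P r) \<Longrightarrow> locally_finite (Con P r) (con_op_order P r)"
  by (fastforce simp: locally_finite_def con_op_order_def conj_commute)

lemma nbd_disjoint: "I \<inter> nbd P r I = {}"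
  by (auto simp: nbd_def)

text \<open>Each point of \<open>S\<close> is Hasse-adjacent to a point of \<open>I\<close>, so
  every point of the union is joined to one base point \<open>a\<close> of \<open>I\<close>;
  symmetry of the Hasse graph does the rest.\<close>

lemma Con_adjoin_nbd:
  assumes "I \<in> Con P r" "S \<subseteq> nbd P r I"
  shows "I \<union> S \<in> Con P r"
proof -
  let ?R = "(Restr (hasse P r) (I \<union> S))\<^sup>*"
  have I: "I \<subseteq> P" "I \<noteq> {}" and c: "\<And>p q. p \<in> I \<Longrightarrow> q \<in> I \<Longrightarrow> (p, q) \<in> (Restr (hasse P r) I)\<^sup>*"
    using assms(1) by (auto simp: Con_def)
  have mono: "(Restr (hasse P r) I)\<^sup>* \<subseteq> ?R"
    by (rule rtrancl_mono) auto
  have sym: "sym ?R"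
    by (rule sym_rtrancl) (auto simp: sym_def hasse_def)
  obtain a where a: "a \<in> I"
    using I by auto
  have to: "(a, p) \<in> ?R" if "p \<in> I \<union> S" for p
  proof (cases "p \<in> I")
    case True
    then show ?thesis
      using c[OF a] mono by auto
  next
    case False
    then have "p \<in> nbd P r I"
      using that assms(2) by auto
    then obtain q where q: "q \<in> I" "(q, p) \<in> hasse P r"
      by (auto simp: nbd_def)
    then have "(a, q) \<in> ?R" "(q, p) \<in> Restr (hasse P r) (I \<union> S)"
      using c[OF a] mono that by auto
    then show ?thesis
      by (rule rtrancl_into_rtrancl)
  qed
  have "(p, q) \<in> ?R" if "p \<in> I \<union> S" "q \<in> I \<union> S" for p q
    using to[OF that(1)] to[OF that(2)] sym by (meson rtrancl_trans symD)
  then show ?thesis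
    using I assms(2) by (auto simp: Con_def nbd_def)
qed

text \<open>A Hasse path inside \<open>J\<close> from a point of \<open>I\<close> to a point outside
  must leave \<open>I\<close>, and the first vertex outside is a neighbour of \<open>I\<close>.
  Without such a vertex, induction along the path stays in \<open>I\<close>.\<close>

lemma Con_psubset_nbd:
  assumes "J \<in> Con P r" "I \<noteq> {}" "I \<subset> J"
  shows "nbd P r I \<inter> J \<noteq> {}"
proof
  assume *: "nbd P r I \<inter> J = {}"
  obtain a b where ab: "a \<in> I" "b \<in> J" "b \<notin> I"
    using assms by auto
  then have "(a, b) \<in> (Restr (hasse P r) J)\<^sup>*"
    using assms by (auto simp: Con_def)
  then have "b \<in> I"
  proof induction
    case (step y z)
    then show ?case
      using * assms by (auto simp: nbd_def Con_def)
  qed (fact ab)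
  with ab show False by simp
qed

lemma con_moebius_eq:
  assumes ess: "essentially_finite P r" and lf: "locally_finite (Con P r) (con_order P r)"
    and I: "I \<in> Con P r" and J: "J \<in> Con P r" and IJ: "I \<subseteq> J"
  shows "con_moebius P r J I = (if J \<subseteq> I \<union> nbd P r I then (- 1) ^ card (J \<inter> nbd P r I) else 0)"
proof -
  let ?g = "\<lambda>K. if K \<subseteq> I \<union> nbd P r I then (- 1) ^ card (K \<inter> nbd P r I) else 0 :: int"
  have "con_moebius P r J I = ?g J"
  \<comment> \<open>The order is reversed inclusion, so \<open>J\<close> is the bottom and
    \<open>I\<close> the top: an \<open>X\<close> in between satisfies
    \<open>I \<subseteq> X \<subseteq> J\<close>, and the sum to evaluate runs over the connected
    \<open>K\<close> with \<open>I \<subseteq> K \<subseteq> X\<close>.\<close>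
  proof (rule moebius_eqI[OF partial_order_con_op locally_finite_con_op[OF lf]])
    show "(J, I) \<in> con_op_order P r"
      using I J IJ by (auto simp: con_op_order_def con_order_def)
    fix X
    assume "(J, X) \<in> con_op_order P r" "(X, I) \<in> con_op_order P r"
    then have X: "X \<in> Con P r" "X \<subseteq> J" "I \<subseteq> X"
      by (auto simp: con_op_order_def con_order_def)
    let ?N = "nbd P r I \<inter> X"
    let ?S = "{K. K \<in> Con P r \<and> (X, K) \<in> con_op_order P r \<and> (K, I) \<in> con_op_order P r}"
    have S: "?S = {K \<in> Con P r. K \<subseteq> X \<and> I \<subseteq> K}"
      using X I by (auto simp: con_op_order_def con_order_def)
    have finS: "finite ?S"
      using lf X(1,3) I by (auto simp: locally_finite_def S con_order_def intro: rev_finite_subset)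
    have finN: "finite ?N"
      using ess I by (auto simp: essentially_finite_def)
    have inj: "inj_on (\<lambda>S. I \<union> S) (Pow ?N)"
      using nbd_disjoint[of I P r] by (intro inj_onI) blast
    \<comment> \<open>The terms that survive correspond to arbitrary subsets of \<open>?N\<close>:
      adjoining neighbours keeps a set connected, so membership in \<open>Con P r\<close> imposes no
      further condition.\<close>
    have img: "(\<lambda>S. I \<union> S) ` Pow ?N = {K \<in> ?S. K \<subseteq> I \<union> nbd P r I}"
    proof (intro subset_antisym subsetI)
      fix K
      assume "K \<in> (\<lambda>S. I \<union> S) ` Pow ?N"
      then show "K \<in> {K \<in> ?S. K \<subseteq> I \<union> nbd P r I}"
        unfolding S using X Con_adjoin_nbd[OF I] by auto
    next
      fix K
      assume "K \<in> {K \<in> ?S. K \<subseteq> I \<union> nbd P r I}"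
      then have "K = I \<union> (K \<inter> ?N)" "K \<inter> ?N \<in> Pow ?N"
        unfolding S by auto
      then show "K \<in> (\<lambda>S. I \<union> S) ` Pow ?N"
        by (rule image_eqI)
    qed
    have "(\<Sum>K\<in>?S. ?g K) = (\<Sum>K | K \<in> ?S \<and> K \<subseteq> I \<union> nbd P r I. (- 1) ^ card (K \<inter> nbd P r I))"
      by (rule sum.inter_filter[OF finS, symmetric])
    also have "\<dots> = (\<Sum>S\<in>Pow ?N. (- 1) ^ card ((I \<union> S) \<inter> nbd P r I))"
      unfolding img[symmetric] by (simp only: sum.reindex[OF inj] o_def)
    also have "\<dots> = (\<Sum>S\<in>Pow ?N. (- 1) ^ card S)"
    proof (rule sum.cong[OF refl])
      fix S
      assume "S \<in> Pow ?N"
      then have "(I \<union> S) \<inter> nbd P r I = S"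
        using nbd_disjoint[of I P r] by auto
      then show "(- 1) ^ card ((I \<union> S) \<inter> nbd P r I) = ((- 1) ^ card S :: int)"
        by simp
    qed
    also have "\<dots> = (if X = I then 1 else 0)"
    proof (cases "X = I")
      case True
      then have "?N = {}"
        using nbd_disjoint[of I P r] by auto
      then show ?thesis
        using True by simp
    next
      case False
      then show ?thesis
        using sum_Pow_alternating[OF finN] Con_psubset_nbd[of X P r I] X I by (auto simp: Con_def)
    qed
    finally show "(\<Sum>K\<in>?S. ?g K) = (if X = I then 1 else 0)" .
  qed
  then show ?thesis .
qed


section \<open>Summing over thickenings\<close>

text \<open>Makes the leading term of the diagram the level n = 0. Finiteness matters because
  \<open>card\<close> also sends infinite sets to 0.\<close>

lemma thickenings_0:
  assumes "finite (nbd P r I)"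
  shows "thickenings P r 0 I = {I}"
proof -
  have "finite (J \<inter> nbd P r I)" for J
    using assms by simp
  then show ?thesis
    using nbd_disjoint[of I P r] by (auto simp: thickenings_def)
qed

lemma finite_thickenings:
  assumes "finite (nbd P r I)"
  shows "finite (thickenings P r n I)"
proof -
  have "finite ((\<lambda>S. I \<union> S) ` Pow (nbd P r I))"
    using assms by simp
  moreover have "thickenings P r n I \<subseteq> (\<lambda>S. I \<union> S) ` Pow (nbd P r I)"
  proof
    fix J
    assume "J \<in> thickenings P r n I"
    then have "J = I \<union> (J \<inter> nbd P r I)"
      by (auto simp: thickenings_def)
    then show "J \<in> (\<lambda>S. I \<union> S) ` Pow (nbd P r I)"
      by blast
  qed
  ultimately show ?thesis
    by (meson finite_subset)
qed

text \<open>The levels grade this family by the number of adjoined neighbours, which is at most the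
  size of the whole neighbourhood.\<close>

lemma Union_thickenings:
  assumes "finite (nbd P r I)"
  shows "(\<Union>n\<le>card (nbd P r I). thickenings P r n I) = {J. I \<subseteq> J \<and> J \<subseteq> I \<union> nbd P r I}"
  using card_mono[OF assms] by (auto simp: thickenings_def)

lemma (in comm_group) finprod_int_pow:
  fixes k :: int
  assumes "f \<in> A \<rightarrow> carrier G"
  shows "finprod G (\<lambda>x. f x [^] k) A = finprod G f A [^] k"
  using assms
proof (induction A rule: infinite_finite_induct)
  case (insert a A)
  then show ?case
    by (subst (1 2) finprod_insert) (auto simp: int_pow_distrib Pi_iff finprod_closed)
\<comment> \<open>For empty and for infinite \<open>A\<close> both products are
  \<open>\<one>\<close>, in the infinite case by the default value of
  \<open>finprod\<close>.\<close>
qed (simp_all add: int_pow_one)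

text \<open>Regroups the product level by level. In multiplicative notation the sign of a summand
  becomes an exponent 1 or -1.\<close>

lemma (in comm_group) finprod_thickenings:
  assumes fin: "finite (nbd P r I)"
    and f: "\<And>J. \<lbrakk>I \<subseteq> J; J \<subseteq> I \<union> nbd P r I\<rbrakk> \<Longrightarrow> f J \<in> carrier G"
  shows "f I \<otimes> finprod G (\<lambda>n. finprod G f (thickenings P r n I) [^] ((- 1) ^ n :: int))
        {1..card (nbd P r I)} =
      finprod G (\<lambda>J. f J [^] ((- 1) ^ card (J \<inter> nbd P r I) :: int)) {J. I \<subseteq> J \<and> J \<subseteq> I \<union> nbd P r I}"
proof -
  let ?N = "card (nbd P r I)"
  let ?h = "\<lambda>n. finprod G f (thickenings P r n I) [^] ((- 1) ^ n :: int)"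
  let ?k = "\<lambda>J. f J [^] ((- 1) ^ card (J \<inter> nbd P r I) :: int)"
  have fT: "f \<in> thickenings P r n I \<rightarrow> carrier G" for n
    using f by (auto simp: thickenings_def)
  have fI: "f I \<in> carrier G"
    using f by auto
  have "f I \<otimes> finprod G ?h {1..?N} = ?h 0 \<otimes> finprod G ?h {1..?N}"
    using fI by (simp add: thickenings_0[OF fin])
  also have "\<dots> = finprod G ?h {..?N}"
  proof -
    have "{..?N} = insert 0 {1..?N}"
      by auto
    then show ?thesis
      using fT by (simp add: finprod_closed Pi_iff)
  qed
  also have "\<dots> = finprod G (\<lambda>n. finprod G ?k (thickenings P r n I)) {..?N}"
  proof (rule finprod_cong')
    fix n
    \<comment> \<open>On level \<open>n\<close> the exponent is constant, so it can be pulled out of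
      the product.\<close>
    have "finprod G ?k (thickenings P r n I) =
        finprod G (\<lambda>J. f J [^] ((- 1) ^ n :: int)) (thickenings P r n I)"
      using fT by (intro finprod_cong') (auto simp: thickenings_def Pi_iff)
    then show "?h n = finprod G ?k (thickenings P r n I)"
      using fT by (simp add: finprod_int_pow)
  qed (use f in \<open>auto intro!: finprod_closed simp: thickenings_def\<close>)
  also have "\<dots> = finprod G ?k (\<Union>n\<le>?N. thickenings P r n I)"
    by (rule finprod_UN_disjoint[symmetric])
      (use finite_thickenings[OF fin] f in \<open>auto simp: pairwise_def disjnt_def thickenings_def\<close>)
  finally show ?thesis
    by (simp add: Union_thickenings[OF fin])
qed


section \<open>Existence of ranks\<close>

text \<open>The isomorphic copy of \<open>J\<close> on the images of \<open>\<phi>\<close> and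
  \<open>\<psi>\<close>. Its structure is computed by pulling back along \<open>inv_into\<close>,
  which inverts the maps under the injectivity assumed in \<open>category_embedding\<close>.\<close>

definition transport_cat :: "('a \<Rightarrow> 'c) \<Rightarrow> ('b \<Rightarrow> 'd) \<Rightarrow> ('a, 'b) cat \<Rightarrow> ('c, 'd) cat" where
  "transport_cat \<phi> \<psi> J =
     (let \<psi>' = inv_into (Arr J) \<psi> in
      \<lparr>Obj = \<phi> ` Obj J, Arr = \<psi> ` Arr J, Dom = (\<lambda>u. \<phi> (Dom J (\<psi>' u))), Cod = (\<lambda>u. \<phi> (Cod J (\<psi>' u))),
       Ident = (\<lambda>x. \<psi> (Ident J (inv_into (Obj J) \<phi> x))), Comp = (\<lambda>v u. \<psi> (\<psi>' v \<cdot>\<^bsub>J\<^esub> \<psi>' u))\<rparr>)"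

definition transport_functor ::
  "('a \<Rightarrow> 'c) \<Rightarrow> ('b \<Rightarrow> 'd) \<Rightarrow> ('a, 'b) cat \<Rightarrow> ('a, 'b, 'o, 'm) functor_data \<Rightarrow> ('c, 'd, 'o, 'm) functor_data" where
  "transport_functor \<phi> \<psi> J F = \<lparr>ob = ob F \<circ> inv_into (Obj J) \<phi>, ar = ar F \<circ> inv_into (Arr J) \<psi>\<rparr>"

locale category_embedding = category J
  for J :: "('a, 'b) cat" +
  fixes \<phi> :: "'a \<Rightarrow> 'c" and \<psi> :: "'b \<Rightarrow> 'd"
  assumes inj_ob: "inj_on \<phi> (Obj J)" and inj_ar: "inj_on \<psi> (Arr J)"
begin

abbreviation "J' \<equiv> transport_cat \<phi> \<psi> J"

lemma Hom_objs: "u \<in> Hom J a b \<Longrightarrow> u \<in> Arr J \<and> a \<in> Obj J \<and> b \<in> Obj J"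
  using Dom_Obj Cod_Obj by (auto simp: Hom_def)

lemma Obj_transport: "Obj J' = \<phi> ` Obj J" and Arr_transport: "Arr J' = \<psi> ` Arr J"
  by (simp_all add: transport_cat_def Let_def)

lemma Hom_transportI: "u \<in> Hom J a b \<Longrightarrow> \<psi> u \<in> Hom J' (\<phi> a) (\<phi> b)"
  by (auto simp: Hom_def transport_cat_def Let_def inv_into_f_f[OF inj_ar])

lemma Hom_transportE:
  assumes "w \<in> Hom J' x y"
  obtains u a b where "u \<in> Hom J a b" "w = \<psi> u" "x = \<phi> a" "y = \<phi> b"
  using assms by (auto simp: Hom_def transport_cat_def Let_def inv_into_f_f[OF inj_ar])

text \<open>Needed for composition: two composable arrows of the copy lift to composable arrows of
  \<open>J\<close> only because injectivity of \<open>\<phi>\<close> identifies the lifts of the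
  middle object.\<close>

lemma Hom_transportE':
  assumes "w \<in> Hom J' (\<phi> a) y" "a \<in> Obj J"
  obtains u b where "u \<in> Hom J a b" "w = \<psi> u" "y = \<phi> b"
  using assms(1)
proof (rule Hom_transportE)
  fix u a' b
  assume *: "u \<in> Hom J a' b" "w = \<psi> u" "\<phi> a = \<phi> a'" "y = \<phi> b"
  then have "a = a'"
    using inj_onD[OF inj_ob] Hom_objs assms(2) by blast
  with * that show thesis by blast
qed

lemma Ident_transport: "a \<in> Obj J \<Longrightarrow> Ident J' (\<phi> a) = \<psi> (Ident J a)"
  by (simp add: transport_cat_def Let_def inv_into_f_f[OF inj_ob])

lemma Comp_transport:
  "\<lbrakk>u \<in> Arr J; v \<in> Arr J\<rbrakk> \<Longrightarrow> \<psi> v \<cdot>\<^bsub>J'\<^esub> \<psi> u = \<psi> (v \<cdot>\<^bsub>J\<^esub> u)"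
  by (simp add: transport_cat_def Let_def inv_into_f_f[OF inj_ar])

lemma category_transport: "category J'"
proof
  fix w
  assume "w \<in> Arr J'"
  then have "w \<in> Hom J' (Dom J' w) (Cod J' w)"
    by (simp add: Hom_def)
  then show "Dom J' w \<in> Obj J'" "Cod J' w \<in> Obj J'"
    by (auto elim!: Hom_transportE dest: Hom_objs simp: Obj_transport)
next
  fix x
  assume "x \<in> Obj J'"
  then show "Ident J' x \<in> Hom J' x x"
    by (auto simp: Obj_transport Ident_transport intro!: Hom_transportI Ident_Hom)
next
  fix w v x y z
  assume w: "w \<in> Hom J' x y" and v: "v \<in> Hom J' y z"
  from w obtain u a b where u: "u \<in> Hom J a b" "w = \<psi> u" "x = \<phi> a" "y = \<phi> b"
    by (rule Hom_transportE)
  have "b \<in> Obj J"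
    using u Hom_objs by blast
  with v u(4) obtain u' c where u': "u' \<in> Hom J b c" "v = \<psi> u'" "z = \<phi> c"
    using Hom_transportE' by metis
  show "v \<cdot>\<^bsub>J'\<^esub> w \<in> Hom J' x z"
    using u u' Hom_objs[of u] Hom_objs[of u'] Hom_transportI[OF Comp_Hom[OF u(1) u'(1)]]
    by (simp add: Comp_transport)
next
  fix w x y
  assume "w \<in> Hom J' x y"
  then obtain u a b where u: "u \<in> Hom J a b" "w = \<psi> u" "x = \<phi> a" "y = \<phi> b"
    by (rule Hom_transportE)
  then have o: "u \<in> Arr J" "a \<in> Obj J" "b \<in> Obj J"
    using Hom_objs by blast+
  then have "Ident J a \<in> Arr J" "Ident J b \<in> Arr J"
    using Ident_Hom by (auto simp: Hom_def)
  then show "w \<cdot>\<^bsub>J'\<^esub> Ident J' x = w" "Ident J' y \<cdot>\<^bsub>J'\<^esub> w = w"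
    using o u by (simp_all add: Ident_transport Comp_transport Comp_Ident Ident_Comp)
next
  fix w v t x y z k
  assume w: "w \<in> Hom J' x y" and v: "v \<in> Hom J' y z" and t: "t \<in> Hom J' z k"
  from w obtain u a b where u: "u \<in> Hom J a b" "w = \<psi> u" "x = \<phi> a" "y = \<phi> b"
    by (rule Hom_transportE)
  have "b \<in> Obj J"
    using u Hom_objs by blast
  with v u(4) obtain u' c where u': "u' \<in> Hom J b c" "v = \<psi> u'" "z = \<phi> c"
    using Hom_transportE' by metis
  have "c \<in> Obj J"
    using u' Hom_objs by blast
  with t u'(3) obtain u'' d where u'': "u'' \<in> Hom J c d" "t = \<psi> u''"
    using Hom_transportE' by metis
  have "u \<in> Arr J" "u' \<in> Arr J" "u'' \<in> Arr J" "u' \<cdot>\<^bsub>J\<^esub> u \<in> Arr J" "u'' \<cdot>\<^bsub>J\<^esub> u' \<in> Arr J"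
    using u u' u'' Comp_Hom Hom_objs by blast+
  then show "t \<cdot>\<^bsub>J'\<^esub> v \<cdot>\<^bsub>J'\<^esub> w = t \<cdot>\<^bsub>J'\<^esub> (v \<cdot>\<^bsub>J'\<^esub> w)"
    using u u' u'' by (simp add: Comp_transport Comp_assoc[OF u(1) u'(1) u''(1)])
qed

lemma ob_transport: "a \<in> Obj J \<Longrightarrow> ob (transport_functor \<phi> \<psi> J F) (\<phi> a) = ob F a"
  by (simp add: transport_functor_def inv_into_f_f[OF inj_ob])

lemma ar_transport: "u \<in> Arr J \<Longrightarrow> ar (transport_functor \<phi> \<psi> J F) (\<psi> u) = ar F u"
  by (simp add: transport_functor_def inv_into_f_f[OF inj_ar])

lemma cat_functor_transport:
  assumes "cat_functor J D F"
  shows "cat_functor J' D (transport_functor \<phi> \<psi> J F)"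
proof -
  interpret F: cat_functor J D F by fact
  interpret J': category J' by (rule category_transport)
  show ?thesis
  proof
    fix x
    assume "x \<in> Obj J'"
    then obtain a where a: "a \<in> Obj J" "x = \<phi> a"
      by (auto simp: Obj_transport)
    then have "Ident J a \<in> Arr J"
      using Ident_Hom by (auto simp: Hom_def)
    with a show "ob (transport_functor \<phi> \<psi> J F) x \<in> Obj D"
      "ar (transport_functor \<phi> \<psi> J F) (Ident J' x) = Ident D (ob (transport_functor \<phi> \<psi> J F) x)"
      by (simp_all add: ob_transport ar_transport Ident_transport F.ob_Obj F.ar_Ident)
  next
    fix w x y
    assume "w \<in> Hom J' x y"
    then obtain u a b where u: "u \<in> Hom J a b" "w = \<psi> u" "x = \<phi> a" "y = \<phi> b"
      by (rule Hom_transportE)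
    then show "ar (transport_functor \<phi> \<psi> J F) w \<in>
        Hom D (ob (transport_functor \<phi> \<psi> J F) x) (ob (transport_functor \<phi> \<psi> J F) y)"
      using Hom_objs[OF u(1)] F.ar_Hom by (simp add: ob_transport ar_transport)
  next
    fix w v x y z
    assume w: "w \<in> Hom J' x y" and v: "v \<in> Hom J' y z"
    from w obtain u a b where u: "u \<in> Hom J a b" "w = \<psi> u" "x = \<phi> a" "y = \<phi> b"
      by (rule Hom_transportE)
    have "b \<in> Obj J"
      using u Hom_objs by blast
    with v u(4) obtain u' c where u': "u' \<in> Hom J b c" "v = \<psi> u'" "z = \<phi> c"
      using Hom_transportE' by metis
    have "u \<in> Arr J" "u' \<in> Arr J" "u' \<cdot>\<^bsub>J\<^esub> u \<in> Arr J"
      using u u' Comp_Hom Hom_objs by blast+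
    then show "ar (transport_functor \<phi> \<psi> J F) (v \<cdot>\<^bsub>J'\<^esub> w) =
        ar (transport_functor \<phi> \<psi> J F) v \<cdot>\<^bsub>D\<^esub> ar (transport_functor \<phi> \<psi> J F) w"
      using u u' by (simp add: ar_transport Comp_transport F.ar_Comp)
  qed
qed

text \<open>Transfers the commutation conditions of cones and of cocones in one stroke.\<close>

lemma Hom_transport_all:
  assumes "\<And>u a b. u \<in> Arr J \<Longrightarrow> Q (\<phi> a) (\<phi> b) (\<psi> u) \<longleftrightarrow> R a b u"
  shows "(\<forall>x y. \<forall>w \<in> Hom J' x y. Q x y w) \<longleftrightarrow> (\<forall>a b. \<forall>u \<in> Hom J a b. R a b u)"
proof (intro iffI allI ballI)
  fix a b u
  assume "\<forall>x y. \<forall>w \<in> Hom J' x y. Q x y w" "u \<in> Hom J a b"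
  then show "R a b u"
    using assms Hom_objs Hom_transportI by blast
next
  fix x y w
  assume *: "\<forall>a b. \<forall>u \<in> Hom J a b. R a b u" "w \<in> Hom J' x y"
  from *(2) show "Q x y w"
    by (rule Hom_transportE) (use *(1) assms Hom_objs in blast)
qed

lemma cone_transport_iff:
  "cone J' D (transport_functor \<phi> \<psi> J F) l \<pi> \<longleftrightarrow> cone J D F l (\<pi> \<circ> \<phi>)"
proof -
  have "(\<forall>x y. \<forall>w \<in> Hom J' x y. ar (transport_functor \<phi> \<psi> J F) w \<cdot>\<^bsub>D\<^esub> \<pi> x = \<pi> y) \<longleftrightarrow>
      (\<forall>a b. \<forall>u \<in> Hom J a b. ar F u \<cdot>\<^bsub>D\<^esub> \<pi> (\<phi> a) = \<pi> (\<phi> b))"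
    by (rule Hom_transport_all) (simp add: ar_transport)
  then show ?thesis
    by (simp add: cone_def Obj_transport ob_transport)
qed

lemma cocone_transport_iff:
  "cocone J' D (transport_functor \<phi> \<psi> J F) k \<iota> \<longleftrightarrow> cocone J D F k (\<iota> \<circ> \<phi>)"
proof -
  have "(\<forall>x y. \<forall>w \<in> Hom J' x y. \<iota> y \<cdot>\<^bsub>D\<^esub> ar (transport_functor \<phi> \<psi> J F) w = \<iota> x) \<longleftrightarrow>
      (\<forall>a b. \<forall>u \<in> Hom J a b. \<iota> (\<phi> b) \<cdot>\<^bsub>D\<^esub> ar F u = \<iota> (\<phi> a))"
    by (rule Hom_transport_all) (simp add: ar_transport)
  then show ?thesis
    by (simp add: cocone_def Obj_transport ob_transport)
qed

text \<open>Legs are total functions with arbitrary values off \<open>Obj J\<close>. Reindexing by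
  \<open>\<phi>\<close> and back recovers them on \<open>Obj J\<close> only, which this lemma shows
  to suffice.\<close>

lemma cone_cong: "\<lbrakk>cone J D F l \<pi>; \<And>j. j \<in> Obj J \<Longrightarrow> \<pi> j = \<pi>' j\<rbrakk> \<Longrightarrow> cone J D F l \<pi>'"
  unfolding cone_def using Hom_objs by metis

lemma cocone_cong: "\<lbrakk>cocone J D F k \<iota>; \<And>j. j \<in> Obj J \<Longrightarrow> \<iota> j = \<iota>' j\<rbrakk> \<Longrightarrow> cocone J D F k \<iota>'"
  unfolding cocone_def using Hom_objs by metis

text \<open>A competing cone over \<open>J\<close> becomes one over the copy by reindexing its legs
  along \<open>inv_into (Obj J) \<phi>\<close>; the mediating arrow is the same.\<close>

lemma limit_cone_transport:
  assumes "limit_cone J' D (transport_functor \<phi> \<psi> J F) l \<pi>"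
  shows "limit_cone J D F l (\<pi> \<circ> \<phi>)"
  unfolding limit_cone_def
proof (intro conjI allI impI)
  show "cone J D F l (\<pi> \<circ> \<phi>)"
    using assms by (simp add: limit_cone_def cone_transport_iff)
  fix l' \<pi>'
  assume "cone J D F l' \<pi>'"
  then have "cone J D F l' (\<pi>' \<circ> inv_into (Obj J) \<phi> \<circ> \<phi>)"
    by (rule cone_cong) (simp add: inv_into_f_f[OF inj_ob])
  then have "\<exists>!h. h \<in> Hom D l' l \<and> (\<forall>x \<in> Obj J'. \<pi> x \<cdot>\<^bsub>D\<^esub> h = (\<pi>' \<circ> inv_into (Obj J) \<phi>) x)"
    using assms by (simp only: limit_cone_def cone_transport_iff)
  then show "\<exists>!h. h \<in> Hom D l' l \<and> (\<forall>j \<in> Obj J. (\<pi> \<circ> \<phi>) j \<cdot>\<^bsub>D\<^esub> h = \<pi>' j)"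
    by (simp add: Obj_transport inv_into_f_f[OF inj_ob])
qed

lemma colimit_cocone_transport:
  assumes "colimit_cocone J' D (transport_functor \<phi> \<psi> J F) k \<iota>"
  shows "colimit_cocone J D F k (\<iota> \<circ> \<phi>)"
  unfolding colimit_cocone_def
proof (intro conjI allI impI)
  show "cocone J D F k (\<iota> \<circ> \<phi>)"
    using assms by (simp add: colimit_cocone_def cocone_transport_iff)
  fix k' \<iota>'
  assume "cocone J D F k' \<iota>'"
  then have "cocone J D F k' (\<iota>' \<circ> inv_into (Obj J) \<phi> \<circ> \<phi>)"
    by (rule cocone_cong) (simp add: inv_into_f_f[OF inj_ob])
  then have "\<exists>!h. h \<in> Hom D k k' \<and> (\<forall>x \<in> Obj J'. h \<cdot>\<^bsub>D\<^esub> \<iota> x = (\<iota>' \<circ> inv_into (Obj J) \<phi>) x)"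
    using assms by (simp only: colimit_cocone_def cocone_transport_iff)
  then show "\<exists>!h. h \<in> Hom D k k' \<and> (\<forall>j \<in> Obj J. h \<cdot>\<^bsub>D\<^esub> (\<iota> \<circ> \<phi>) j = \<iota>' j)"
    by (simp add: Obj_transport inv_into_f_f[OF inj_ob])
qed

end

text \<open>\<^const>\<open>bicomplete\<close> only mentions index categories living in \<open>'u\<close>.\<close>
lemma bicomplete_limits:
  assumes bi: "bicomplete TYPE('u) D" and J: "small_category TYPE('u) J" and F: "cat_functor J D F"
  obtains l \<pi> k \<iota> where "limit_cone J D F l \<pi>" "colimit_cocone J D F k \<iota>"
proof -
  \<comment> \<open>Being of smaller cardinality than \<open>'u\<close> includes having an injection
    into \<open>'u\<close>.\<close>
  obtain \<phi> :: "_ \<Rightarrow> 'u" where \<phi>: "inj_on \<phi> (Obj J)"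
    using J by (auto simp: small_category_def small_def lesspoll_def lepoll_def)
  obtain \<psi> :: "_ \<Rightarrow> 'u" where \<psi>: "inj_on \<psi> (Arr J)"
    using J by (auto simp: small_category_def small_def lesspoll_def lepoll_def)
  interpret category J
    using J by (simp add: small_category_def)
  interpret category_embedding J \<phi> \<psi>
    by unfold_locales (fact \<phi> \<psi>)+
  \<comment> \<open>An image is no larger than its source, so the copy is still small.\<close>
  have "\<phi> ` Obj J \<lesssim> Obj J" "\<psi> ` Arr J \<lesssim> Arr J"
    by (rule image_lepoll)+
  then have "small_category TYPE('u) J'"
    using J by (auto simp: small_category_def small_def Obj_transport Arr_transport category_transport
        intro: lesspoll_trans1)
  moreover have "cat_functor J' D (transport_functor \<phi> \<psi> J F)"
    by (rule cat_functor_transport[OF F])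
  ultimately obtain l \<pi> k \<iota> where "limit_cone J' D (transport_functor \<phi> \<psi> J F) l \<pi>"
    "colimit_cocone J' D (transport_functor \<phi> \<psi> J F) k \<iota>"
    using bi unfolding bicomplete_def by metis
  then show thesis
    by (rule that[OF limit_cone_transport colimit_cocone_transport])
qed

section \<open>Changing the target category and restricting the index poset\<close>

lemma Hom_full_subcategory:
  assumes "full_subcategory C D" "a \<in> Obj C" "b \<in> Obj C"
  shows "Hom C a b = Hom D a b"
  using assms by (fastforce simp: full_subcategory_def Hom_def)

lemma cat_functor_full_subcategory:
  assumes "cat_functor J C F" "category D" "full_subcategory C D"
  shows "cat_functor J D F"
proof -
  interpret F: cat_functor J C F by fact
  interpret D: category D by fact
  have obj: "a \<in> Obj J \<and> b \<in> Obj J" if "u \<in> Hom J a b" for u a b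
    using that F.J.Dom_Obj F.J.Cod_Obj by (auto simp: Hom_def)
  show ?thesis
  proof
    fix j
    assume "j \<in> Obj J"
    then show "ob F j \<in> Obj D" "ar F (Ident J j) = Ident D (ob F j)"
      using F.ob_Obj F.ar_Ident assms(3) by (auto simp: full_subcategory_def)
  next
    fix u i j
    assume "u \<in> Hom J i j"
    then show "ar F u \<in> Hom D (ob F i) (ob F j)"
      using F.ar_Hom F.ob_Obj obj Hom_full_subcategory[OF assms(3)] by blast
  next
    fix u v i j k
    assume uv: "u \<in> Hom J i j" "v \<in> Hom J j k"
    then have "ar F u \<in> Hom C (ob F i) (ob F j)" "ar F v \<in> Hom C (ob F j) (ob F k)"
      by (simp_all add: F.ar_Hom)
    then have "ar F v \<cdot>\<^bsub>C\<^esub> ar F u = ar F v \<cdot>\<^bsub>D\<^esub> ar F u"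
      using assms(3) by (simp add: full_subcategory_def Hom_def)
    then show "ar F (v \<cdot>\<^bsub>J\<^esub> u) = ar F v \<cdot>\<^bsub>D\<^esub> ar F u"
      using uv by (simp add: F.ar_Comp)
  qed
qed

lemma Hom_poset_cat: "Hom (poset_cat I r) p q = (if p \<in> I \<and> q \<in> I \<and> (p, q) \<in> r then {(p, q)} else {})"
  by (auto simp: Hom_def poset_cat_def)

lemma cat_functor_poset_restrict:
  assumes "cat_functor (poset_cat P r) C F" "partial_order_on P r" "I \<subseteq> P"
  shows "cat_functor (poset_cat I r) C F"
proof -
  interpret F: cat_functor "poset_cat P r" C F by fact
  interpret J: category "poset_cat I r"
    by (rule category_poset_cat) fact+
  have H: "u \<in> Hom (poset_cat P r) p q" if "u \<in> Hom (poset_cat I r) p q" for u p q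
    using that assms(3) by (auto simp: Hom_poset_cat split: if_splits)
  \<comment> \<open>Identities and composition in \<open>poset_cat\<close> do not refer to the
    underlying set, so the functor laws are inherited.\<close>
  have same: "Ident (poset_cat I r) = Ident (poset_cat P r)" "Comp (poset_cat I r) = Comp (poset_cat P r)"
    by (simp_all add: poset_cat_def)
  have ob: "j \<in> Obj (poset_cat P r)" if "j \<in> Obj (poset_cat I r)" for j
    using that assms(3) by (auto simp: poset_cat_def)
  show ?thesis
    by unfold_locales (simp_all add: same F.ob_Obj F.ar_Hom F.ar_Ident F.ar_Comp[OF H H] ob H)
qed

lemma small_poset_restrict:
  assumes "small_category U (poset_cat P r)" "partial_order_on P r" "I \<subseteq> P"
  shows "small_category U (poset_cat I r)"
proof -
  have "I \<lesssim> P" "Restr r I \<lesssim> Restr r P"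
    using assms(3) by (auto intro!: subset_imp_lepoll)
  then show ?thesis
    using assms category_poset_cat[of P r I]
    by (auto simp: small_category_def small_def poset_cat_def intro: lesspoll_trans1)
qed

section \<open>Images and the objects representing ranks\<close>

text \<open>Precomposing can only shrink the image: \<open>f \<cdot> p\<close> factors through the
  monomorphism \<open>h\<close>, so minimality of its own image yields \<open>u\<close> with
  \<open>h \<cdot> u = h'\<close>. Since \<open>h'\<close> is monic, so is \<open>u\<close>.\<close>

lemma (in category) image_comp_monic:
  assumes f: "f \<in> Hom C a b" and p: "p \<in> Hom C l a"
    and im: "image_factorization C f g h" and im': "image_factorization C (f \<cdot> p) g' h'"
  obtains u where "monic C u" "Dom C u = Dom C h'" "Cod C u = Dom C h"
proof -
  have h: "monic C h" "g \<in> Hom C a (Dom C h)" "Cod C h = b" "f = h \<cdot> g"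
    using im f by (auto simp: image_factorization_def mono_factorization_def Hom_def)
  have fp: "f \<cdot> p \<in> Hom C l b"
    using Comp_Hom[OF p f] .
  have hH: "h \<in> Hom C (Dom C h) b"
    using h by (auto simp: monic_def Hom_def)
  have "f \<cdot> p = h \<cdot> (g \<cdot> p)"
    using Comp_assoc[OF p h(2) hH] h(4) by simp
  then have "mono_factorization C (f \<cdot> p) (g \<cdot> p) h"
    using h fp Comp_Hom[OF p h(2)] by (simp add: mono_factorization_def Hom_def)
  then obtain u where u: "u \<in> Hom C (Dom C h') (Dom C h)" "h \<cdot> u = h'"
    using im' unfolding image_factorization_def by blast
  have h': "monic C h'"
    using im' by (simp add: image_factorization_def mono_factorization_def)
  have "monic C u"
    unfolding monic_def
  proof (intro conjI allI ballI impI)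
    show "u \<in> Arr C"
      using u by (simp add: Hom_def)
    fix x v w
    assume vw: "v \<in> Hom C x (Dom C u)" "w \<in> Hom C x (Dom C u)" "u \<cdot> v = u \<cdot> w"
    then have vw': "v \<in> Hom C x (Dom C h')" "w \<in> Hom C x (Dom C h')"
      using u by (auto simp: Hom_def)
    then have "h' \<cdot> v = h' \<cdot> w"
      using Comp_assoc[OF _ u(1) hH] vw(3) u(2) by metis
    then show "v = w"
      using h' vw' by (auto simp: monic_def)
  qed
  with u that show thesis
    by (auto simp: Hom_def)
qed

lemma rank_object_exists:
  assumes std: "standing_assumptions TYPE('u) C T D"
    and po: "partial_order_on P r" and small: "small_category TYPE('u) (poset_cat P r)"
    and F: "cat_functor (poset_cat P r) C F" and I: "I \<subseteq> P" "I \<noteq> {}"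
  shows "\<exists>x. rank_object D r F I x"
proof -
  interpret C: symmetric_monoidal_category C T
    using std by (simp add: standing_assumptions_def)
  have D: "category D" "bicomplete TYPE('u) D"
    using std C.category_axioms by (auto simp: standing_assumptions_def)
  have im: "\<exists>g h. image_factorization D f g h" if "f \<in> Arr D" for f
    using std that unfolding standing_assumptions_def by blast
  interpret D: category D by fact
  have FI: "cat_functor (poset_cat I r) C F"
    by (rule cat_functor_poset_restrict[OF F po I(1)])
  have FD: "cat_functor (poset_cat I r) D F"
    using std FI cat_functor_full_subcategory[OF FI D(1)] by (auto simp: standing_assumptions_def)
  obtain l \<pi> k \<iota> where lk: "limit_cone (poset_cat I r) D F l \<pi>" "colimit_cocone (poset_cat I r) D F k \<iota>"
    by (rule bicomplete_limits[OF D(2) small_poset_restrict[OF small po I(1)] FD])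
  obtain a where a: "a \<in> I"
    using I by auto
  then have "\<pi> a \<in> Hom D l (ob F a)" "\<iota> a \<in> Hom D (ob F a) k"
    using lk by (simp_all add: limit_cone_def cone_def colimit_cocone_def cocone_def poset_cat_def)
  then have "\<iota> a \<cdot>\<^bsub>D\<^esub> \<pi> a \<in> Arr D"
    using D.Comp_Hom by (auto simp: Hom_def)
  then show ?thesis
    using im lk a unfolding rank_object_def by blast
qed

text \<open>In case (b) of the standing assumptions, the image of \<open>\<iota> a\<close> is a quotient of \<open>ob F a\<close>, and the image of
  \<open>\<iota> a \<cdot> \<pi> a\<close> is a subobject of it.\<close>
lemma rank_object_Obj:
  assumes std: "standing_assumptions U C T D"
    and F: "cat_functor (poset_cat P r) C F" and I: "I \<subseteq> P" and x: "rank_object D r F I x"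
  shows "x \<in> Obj C"
proof -
  interpret C: symmetric_monoidal_category C T
    using std by (simp add: standing_assumptions_def)
  interpret F: cat_functor "poset_cat P r" C F by fact
  obtain l \<pi> k \<iota> a g h where *: "limit_cone (poset_cat I r) D F l \<pi>"
    "colimit_cocone (poset_cat I r) D F k \<iota>" "a \<in> I"
    "image_factorization D (\<iota> a \<cdot>\<^bsub>D\<^esub> \<pi> a) g h" "x = Dom D h"
    using x by (auto simp: rank_object_def)
  have h: "h \<in> Arr D"
    using * by (simp add: image_factorization_def mono_factorization_def monic_def)
  consider (a) "D = C"
    | (b) "category D" "\<And>f. f \<in> Arr D \<Longrightarrow> \<exists>g h. image_factorization D f g h \<and> epic D g"
        "\<And>h. monic D h \<Longrightarrow> Cod D h \<in> Obj C \<Longrightarrow> Dom D h \<in> Obj C"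
        "\<And>g. epic D g \<Longrightarrow> Dom D g \<in> Obj C \<Longrightarrow> Cod D g \<in> Obj C"
    using std by (auto simp: standing_assumptions_def)
  then show ?thesis
  proof cases
    case a
    then show ?thesis
      using * h C.Dom_Obj by simp
  next
    case b
    interpret D: category D by fact
    have H: "\<pi> a \<in> Hom D l (ob F a)" "\<iota> a \<in> Hom D (ob F a) k"
      using * by (simp_all add: limit_cone_def cone_def colimit_cocone_def cocone_def poset_cat_def)
    then obtain g' h' where im: "image_factorization D (\<iota> a) g' h'" "epic D g'"
      using b(2)[of "\<iota> a"] by (auto simp: Hom_def)
    have g': "Dom D g' = ob F a" "Cod D g' = Dom D h'"
      using im H by (auto simp: image_factorization_def mono_factorization_def Hom_def)
    have "a \<in> Obj (poset_cat P r)"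
      using I *(3) by (auto simp: poset_cat_def)
    \<comment> \<open>Neither the limit \<open>l\<close> nor the colimit \<open>k\<close> need lie
      in \<open>C\<close>, so membership in \<open>C\<close> has to be passed on from
      \<open>ob F a\<close>.\<close>
    then have "Dom D h' \<in> Obj C"
      using b(4)[OF im(2)] g' F.ob_Obj by simp
    moreover obtain u where "monic D u" "Dom D u = Dom D h" "Cod D u = Dom D h'"
      using D.image_comp_monic[OF H(2,1) im(1) *(4)] .
    ultimately show ?thesis
      using b(3) *(5) by metis
  qed
qed

text \<open>Existence of a rank object makes the choice by \<open>SOME\<close> in
  \<open>rank_invariant\<close> meaningful. The group laws for \<open>finprod\<close> require its
  factors to lie in the carrier.\<close>

lemma completed_rank_closed:
  assumes "standing_assumptions TYPE('u) C T D" "partial_order_on P r"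
    "small_category TYPE('u) (poset_cat P r)" "cat_functor (poset_cat P r) C F" "J \<in> Con P r"
  shows "completed_rank C T D r F J \<in> carrier (completed_iso_monoid C T)"
proof -
  interpret C: symmetric_monoidal_category C T
    using assms(1) by (simp add: standing_assumptions_def)
  interpret M: comm_monoid "iso_monoid C T"
    by (rule C.comm_monoid_iso_monoid)
  have J: "J \<subseteq> P" "J \<noteq> {}"
    using assms(5) by (auto simp: Con_def)
  have "rank_object D r F J (SOME x. rank_object D r F J x)"
    by (rule someI_ex) (rule rank_object_exists[OF assms(1-4) J])
  then have "rank_invariant C D r F J \<in> carrier (iso_monoid C T)"
    using rank_object_Obj[OF assms(1,4) J(1)] by (simp add: rank_invariant_def iso_monoid_def)
  then show ?thesis
    using M.completion_map_hom by (auto simp: completed_rank_def hom_def)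
qed


section \<open>The diagram as a Moebius inversion\<close>

text \<open>The group completion is written multiplicatively, so integer multiples appear as powers.
  The finiteness claim ensures that the right-hand \<open>finprod\<close> is a genuine sum and not
  its default value on infinite index sets.\<close>

theorem proposition3p19:
  fixes C D :: "('o, 'm) cat" and T :: "('o, 'm) sym_monoidal"
    and P :: "'p set" and r :: "'p rel"
    and F :: "('p, 'p \<times> 'p, 'o, 'm) functor_data"
    and I :: "'p set"
  assumes "standing_assumptions TYPE('u) C T D"
    and "partial_order_on P r" and "small_category TYPE('u) (poset_cat P r)"
    and "connected_poset P r" and "essentially_finite P r"
    and "locally_finite (Con P r) (con_order P r)"
    and "cat_functor (poset_cat P r) C F"
    and "I \<in> Con P r"
  shows "finite {J \<in> Con P r. I \<subseteq> J \<and> con_moebius P r J I \<noteq> 0} \<and>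
    persistence_diagram C T D P r F I =
      finprod (completed_iso_monoid C T)
        (\<lambda>J. completed_rank C T D r F J [^]\<^bsub>completed_iso_monoid C T\<^esub> con_moebius P r J I)
        {J \<in> Con P r. I \<subseteq> J \<and> con_moebius P r J I \<noteq> 0}"
proof -
  interpret C: symmetric_monoidal_category C T
    using assms(1) by (simp add: standing_assumptions_def)
  interpret M: comm_monoid "iso_monoid C T"
    by (rule C.comm_monoid_iso_monoid)
  interpret A: comm_group "completed_iso_monoid C T"
    by (rule M.comm_group_group_completion)
  let ?N = "nbd P r I"
  let ?rk = "completed_rank C T D r F"
  let ?B = "{J. I \<subseteq> J \<and> J \<subseteq> I \<union> ?N}"
  have fin: "finite ?N"
    using assms(5,8) by (simp add: essentially_finite_def)
  have Con: "J \<in> Con P r" if "J \<in> ?B" for J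
  proof -
    have "J = I \<union> (J \<inter> ?N)"
      using that by auto
    then show ?thesis
      using Con_adjoin_nbd[OF assms(8), of "J \<inter> ?N"] by simp
  qed
  note closed = completed_rank_closed[OF assms(1-3,7)]
  note mu = con_moebius_eq[OF assms(5,6,8)]
  \<comment> \<open>On \<open>?B\<close> the Moebius value is 1 or -1, never 0, so the support is
    all of \<open>?B\<close>.\<close>
  have supp: "{J \<in> Con P r. I \<subseteq> J \<and> con_moebius P r J I \<noteq> 0} = ?B"
    using Con mu by (auto split: if_splits)
  have "finite ?B"
    using finite_thickenings[OF fin] by (simp flip: Union_thickenings[OF fin])
  moreover have "persistence_diagram C T D P r F I =
      finprod (completed_iso_monoid C T)
        (\<lambda>J. ?rk J [^]\<^bsub>completed_iso_monoid C T\<^esub> ((- 1) ^ card (J \<inter> ?N) :: int)) ?B"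
    unfolding persistence_diagram_def
    by (rule A.finprod_thickenings[OF fin]) (use Con closed in auto)
  \<comment> \<open>The sign of each term is exactly its Moebius value.\<close>
  moreover have "\<dots> = finprod (completed_iso_monoid C T)
        (\<lambda>J. ?rk J [^]\<^bsub>completed_iso_monoid C T\<^esub> con_moebius P r J I) ?B"
    using Con closed by (intro A.finprod_cong') (auto simp: mu)
  ultimately show ?thesis
    unfolding supp by simp
qed

end
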